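(* Let $c>1$ be a constant and, for each integer $n\ge c$, let $H_n$ be the giant component of the Erdős–Rényi random graph $G(n,c/n)$. Then for every real $\delta\ge 0$, the graph $H_n$ is not $\delta$-hyperbolic asymptotically almost surely, i.e. $$\lim_{n\to\infty}\mathbb{P}\big(H_n \text{ is not } \delta\text{-hyperbolic}\big)=1 .$$
   Context: $G(n,p)$ is the random graph on $n$ labelled vertices in which each unordered pair of distinct vertices is joined by an edge independently with probability $p$. The giant component of $G(n,c/n)$, $c>1$, is its connected component with the largest number of vertices. (It is well known that with probability tending to $1$ it is unique and has size proportional to $n$; how ties are broken is irrelevant.) A connected graph is regarded as a metric space with the shortest-path distance $d$, each edge having length $1$. For vertices $X,Y$, $[XY]$ denotes a shortest path between $X$ and $Y$. A (geodesic) triangle with vertices $X,Y,Z$ consists of a choice of shortest paths $[XY]$, $[YZ]$, $[ZX]$. For a path $P$ and $\delta\ge 0$, $\mathcal{N}(P,\delta)$ is the $\delta$-neighbourhood of $P$, i.e. the set of points at distance at most $\delta$ from $P$. The triangle is $\delta$-thin if $[XY]\subseteq \mathcal{N}([YZ],\delta)\cup\mathcal{N}([ZX],\delta)$. The graph is $\delta$-hyperbolic if all its triangles (for all vertices $X,Y,Z$, in every order, and all choices of shortest paths) are $\delta$-thin. A property of a sequence of random graphs holds asymptotically almost surely if the probability that it holds for the $n$-th graph tends to $1$ as $n\to\infty$. *)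

theory Defs
  imports "HOL-Probability.Probability" "HOL-Probability.Product_PMF"
begin

section \<open>Finite simple graphs\<close>

text \<open>A graph is a vertex set \<open>V\<close> together with a set \<open>E\<close> of two-element subsets of \<open>V\<close>.\<close>

definition vertex_pairs :: "'a set \<Rightarrow> 'a set set" where
  "vertex_pairs V = {e. e \<subseteq> V \<and> card e = 2}"

definition adj_rel :: "'a set set \<Rightarrow> ('a \<times> 'a) set" where
  "adj_rel E = {(u, v). {u, v} \<in> E}"

definition components :: "'a set \<Rightarrow> 'a set set \<Rightarrow> 'a set set" where
  "components V E = {C. \<exists>u\<in>V. C = {v \<in> V. (u, v) \<in> (adj_rel E)\<^sup>*}}"

definition induced_edges :: "'a set set \<Rightarrow> 'a set \<Rightarrow> 'a set set" where
  "induced_edges E C = {e \<in> E. e \<subseteq> C}"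

text \<open>In case of ties there are several largest components.\<close>

definition largest_component :: "'a set \<Rightarrow> 'a set set \<Rightarrow> 'a set \<Rightarrow> bool" where
  "largest_component V E C \<longleftrightarrow>
     C \<in> components V E \<and> (\<forall>D\<in>components V E. card D \<le> card C)"

section \<open>Shortest-path distance and geodesics\<close>

text \<open>Only meaningful for \<open>u\<close>, \<open>v\<close> in the same connected component.\<close>

definition graph_dist :: "'a set set \<Rightarrow> 'a \<Rightarrow> 'a \<Rightarrow> nat" where
  "graph_dist E u v = (LEAST k. (u, v) \<in> adj_rel E ^^ k)"

text \<open>A path is given by the list of its successive vertices.\<close>

definition shortest_path :: "'a set set \<Rightarrow> 'a \<Rightarrow> 'a \<Rightarrow> 'a list \<Rightarrow> bool" where
  "shortest_path E u v xs \<longleftrightarrow>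
     xs \<noteq> [] \<and> hd xs = u \<and> last xs = v \<and>
     successively (\<lambda>x y. {x, y} \<in> E) xs \<and>
     length xs = Suc (graph_dist E u v)"

section \<open>The graph as a metric space with edges of length 1\<close>

text \<open>
  Points of the geometric realization are given by their barycentric coordinates: the vertex
  \<open>v\<close> is the indicator function of \<open>{v}\<close>, and the point of the edge \<open>{u, v}\<close> at
  distance \<open>t\<close> from \<open>u\<close> has coordinate \<open>1 - t\<close> at \<open>u\<close>, \<open>t\<close> at \<open>v\<close> and \<open>0\<close> elsewhere.
\<close>

definition support :: "('a \<Rightarrow> real) \<Rightarrow> 'a set" where
  "support f = {v. f v \<noteq> 0}"

definition realization :: "'a set \<Rightarrow> 'a set set \<Rightarrow> ('a \<Rightarrow> real) set" where
  "realization V E =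
     {f. (\<forall>v. 0 \<le> f v) \<and>
         (\<exists>s \<in> (\<lambda>v. {v}) ` V \<union> E. support f \<subseteq> s \<and> (\<Sum>v\<in>s. f v) = 1)}"

text \<open>
  The length metric. Two points of a common edge \<open>{u, v}\<close> are at distance
  \<open>\<bar>f u - g u\<bar> = \<bar>f v - g v\<bar>\<close>. Otherwise a shortest connection leaves the (closed) edge of
  \<open>f\<close> at one of its endpoints \<open>u\<close> and enters that of \<open>g\<close> at one of its endpoints \<open>x\<close>;
  the distances from \<open>f\<close> to \<open>u\<close> and from \<open>x\<close> to \<open>g\<close> are \<open>1 - f u\<close> and \<open>1 - g x\<close>.
\<close>

definition point_dist :: "'a set set \<Rightarrow> ('a \<Rightarrow> real) \<Rightarrow> ('a \<Rightarrow> real) \<Rightarrow> real" where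
  "point_dist E f g =
     (if \<exists>e\<in>E. support f \<union> support g \<subseteq> e
      then Max ((\<lambda>v. \<bar>f v - g v\<bar>) ` (support f \<union> support g))
      else Min ((\<lambda>(u, x). (1 - f u) + real (graph_dist E u x) + (1 - g x)) `
                  (support f \<times> support g)))"

definition path_edges :: "'a list \<Rightarrow> 'a set set" where
  "path_edges xs = {{xs ! i, xs ! Suc i} | i. Suc i < length xs}"

definition path_points :: "'a list \<Rightarrow> ('a \<Rightarrow> real) set" where
  "path_points xs = realization (set xs) (path_edges xs)"

text \<open>Path point sets are compact, so distance at most \<open>\<delta>\<close> from the set is attained.\<close>

definition nbhd :: "'a set \<Rightarrow> 'a set set \<Rightarrow> ('a \<Rightarrow> real) set \<Rightarrow> real \<Rightarrow> ('a \<Rightarrow> real) set" where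
  "nbhd V E P \<delta> = {f \<in> realization V E. \<exists>g\<in>P. point_dist E f g \<le> \<delta>}"

section \<open>Hyperbolicity\<close>

definition thin_triangle ::
    "'a set \<Rightarrow> 'a set set \<Rightarrow> real \<Rightarrow> 'a list \<Rightarrow> 'a list \<Rightarrow> 'a list \<Rightarrow> bool" where
  "thin_triangle V E \<delta> xy yz zx \<longleftrightarrow>
     path_points xy \<subseteq> nbhd V E (path_points yz) \<delta> \<union> nbhd V E (path_points zx) \<delta>"

definition hyperbolic :: "'a set \<Rightarrow> 'a set set \<Rightarrow> real \<Rightarrow> bool" where
  "hyperbolic V E \<delta> \<longleftrightarrow>
     (\<forall>X\<in>V. \<forall>Y\<in>V. \<forall>Z\<in>V. \<forall>xy yz zx.
        shortest_path E X Y xy \<longrightarrow> shortest_path E Y Z yz \<longrightarrow> shortest_path E Z X zx \<longrightarrow>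
        thin_triangle V E \<delta> xy yz zx)"

section \<open>The random graph\<close>

text \<open>The law of the edge set of \<open>G(n, p)\<close> on the vertex set \<open>{1..n}\<close>, for \<open>0 \<le> p \<le> 1\<close>.\<close>

definition gnp :: "nat \<Rightarrow> real \<Rightarrow> nat set set pmf" where
  "gnp n p =
     map_pmf (\<lambda>\<omega>. {e \<in> vertex_pairs {1..n}. \<omega> e})
       (Pi_pmf (vertex_pairs {1..n}) False (\<lambda>_. bernoulli_pmf p))"

end

(*
  If every geodesic triangle is thin, then every isometric cycle is shorter than a constant K,
  since an isometric cycle of length L contains a geodesic triangle one of whose sides has a point
  at distance about L/6 from the two others. Then the cycles of length at most K span the cycle
  space over GF(2): a shortest closed walk crossing a given edge set A an odd number of times is
  isometric. But the expected number of cycles of length at most K in G(n, c/n) is bounded, while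
  the cycle space of the largest component has dimension tending to infinity. The latter follows
  from two first-moment bounds.

  (1) Explore the components of the vertices 1, 2, ... one after the other. For small a, with high
  probability no set reached on the way has size k in [an, 2an]: such a set carries a spanning
  forest rooted in {1..j} and sends no edge to its complement, which has probability at most
  (c e^(1 - c + ck/n))^k. Hence the size jumps over that interval, and some component has at least
  an vertices.

  (2) The expected number of components of size k = xn >= an having at most M edges outside a
  spanning tree is at most a polynomial in n times exp(n g(x)), where g < 0 on (0, 1].
*)

theory Submission
  imports Defs
begin

section \<open>Elementary facts on edges of simple graphs\<close>

lemma finite_vertex_pairs: "finite V \<Longrightarrow> finite (vertex_pairs V)"
  by (rule finite_subset[of _ "Pow V"]) (auto simp: vertex_pairs_def)

lemma edge_neq: "E \<subseteq> vertex_pairs V \<Longrightarrow> {u, v} \<in> E \<Longrightarrow> u \<noteq> v"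
  by (auto simp: vertex_pairs_def)

lemma edge_mem: "E \<subseteq> vertex_pairs V \<Longrightarrow> {u, v} \<in> E \<Longrightarrow> u \<in> V \<and> v \<in> V"
  by (auto simp: vertex_pairs_def)

lemma sym_adj_rel: "sym (adj_rel E)"
  by (auto simp: sym_def adj_rel_def insert_commute)

section \<open>Spanning forests\<close>

text \<open>The parent of a vertex is a neighbour closer to the set of roots.\<close>

lemma spanning_forest:
  assumes "\<And>v. v \<in> S \<Longrightarrow> \<exists>r\<in>R. (r, v) \<in> (adj_rel E)\<^sup>*"
    and closed: "\<And>u v. {u, v} \<in> E \<Longrightarrow> v \<in> S \<Longrightarrow> u \<in> S"
  obtains f where "f \<in> S - R \<rightarrow>\<^sub>E S"
    and "\<And>v. v \<in> S - R \<Longrightarrow> {v, f v} \<in> E"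
    and "inj_on (\<lambda>v. {v, f v}) (S - R)"
    and "\<And>v. v \<in> S \<Longrightarrow> \<exists>r\<in>R. (r, v) \<in> (adj_rel ((\<lambda>v. {v, f v}) ` (S - R)))\<^sup>*"
proof -
  define rk where "rk v = (LEAST k. \<exists>r\<in>R. (r, v) \<in> adj_rel E ^^ k)" for v
  have rk: "\<exists>r\<in>R. (r, v) \<in> adj_rel E ^^ rk v" if "v \<in> S" for v
  proof -
    have "\<exists>k. \<exists>r\<in>R. (r, v) \<in> adj_rel E ^^ k"
      using assms(1)[OF that] by (auto simp: rtrancl_power)
    then show ?thesis unfolding rk_def by (rule LeastI_ex)
  qed
  have ex: "\<exists>u. u \<in> S \<and> {v, u} \<in> E \<and> rk u < rk v" if v: "v \<in> S - R" for v
  proof -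
    obtain r where r: "r \<in> R" "(r, v) \<in> adj_rel E ^^ rk v" using rk v by blast
    with v have "rk v \<noteq> 0" by (metis DiffE relpow_0_E)
    then obtain k where k: "rk v = Suc k" using not0_implies_Suc by blast
    then obtain u where u: "(r, u) \<in> adj_rel E ^^ k" "(u, v) \<in> adj_rel E"
      using r by auto
    have "rk u \<le> k" unfolding rk_def using r u by (intro Least_le) blast
    have "{u, v} \<in> E" using u(2) by (simp add: adj_rel_def)
    then have "u \<in> S" "{v, u} \<in> E" using closed v by (auto simp: insert_commute)
    with \<open>rk u \<le> k\<close> k show ?thesis by auto
  qed
  define f where "f = (\<lambda>v\<in>S - R. SOME u. u \<in> S \<and> {v, u} \<in> E \<and> rk u < rk v)"
  have f: "f v \<in> S \<and> {v, f v} \<in> E \<and> rk (f v) < rk v" if "v \<in> S - R" for v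
    using someI_ex[OF ex[OF that]] that by (simp add: f_def)
  let ?T = "(\<lambda>v. {v, f v}) ` (S - R)"
  show ?thesis
  proof
    show "f \<in> S - R \<rightarrow>\<^sub>E S" using f by (auto simp: f_def)
    show "{v, f v} \<in> E" if "v \<in> S - R" for v using f that by blast
    \<comment> \<open>If two vertices \<open>v\<close> and \<open>w\<close> gave the same edge, each
      would be the parent of the other, and \<open>rk\<close> would decrease in both
      directions.\<close>
    show "inj_on (\<lambda>v. {v, f v}) (S - R)"
      using f by (intro inj_onI) (metis doubleton_eq_iff less_asym)
    show "\<exists>r\<in>R. (r, v) \<in> (adj_rel ?T)\<^sup>*" if "v \<in> S" for v
      using that
    proof (induction "rk v" arbitrary: v rule: less_induct)
      case less
      show ?case
      proof (cases "v \<in> R")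
        case False
        with less obtain r where r: "r \<in> R" "(r, f v) \<in> (adj_rel ?T)\<^sup>*" using f by blast
        have "(f v, v) \<in> adj_rel ?T" using False less by (auto simp: adj_rel_def)
        with r show ?thesis by (meson rtrancl.rtrancl_into_rtrancl)
      qed auto
    qed
  qed
qed

section \<open>Shortest odd closed walks are isometric\<close>

text \<open>
  The double cover of the graph in which the sheet changes along the edges of \<open>A\<close>: closed walks
  with an odd number of steps in \<open>A\<close> lift to walks between the two points above a vertex.
\<close>

definition cover :: "'a set set \<Rightarrow> 'a set set \<Rightarrow> (('a \<times> bool) \<times> ('a \<times> bool)) set" where
  "cover E A = {((u, a), (v, b)). {u, v} \<in> E \<and> b = (a \<noteq> ({u, v} \<in> A))}"

lemma cover_sym: "(x, y) \<in> cover E A ^^ k \<Longrightarrow> (y, x) \<in> cover E A ^^ k"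
proof -
  have "sym (cover E A)" by (auto simp: sym_def cover_def insert_commute)
  then have "sym (cover E A ^^ k)"
    by (induction k) (auto simp: sym_conv_converse_eq converse_relcomp relpow_commute)
  then show "(x, y) \<in> cover E A ^^ k \<Longrightarrow> (y, x) \<in> cover E A ^^ k" by (rule symD)
qed

text \<open>Exchanging the two sheets is an automorphism of the double cover.\<close>

lemma cover_flip: "((u, a), (v, b)) \<in> cover E A ^^ k \<Longrightarrow> ((u, \<not> a), (v, \<not> b)) \<in> cover E A ^^ k"
proof (induction k arbitrary: v b)
  case (Suc k)
  then obtain w c where "((u, a), (w, c)) \<in> cover E A ^^ k" "((w, c), (v, b)) \<in> cover E A"
    by auto
  then have "((u, \<not> a), (w, \<not> c)) \<in> cover E A ^^ k" "((w, \<not> c), (v, \<not> b)) \<in> cover E A"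
    using Suc.IH[of w c] by (auto simp: cover_def)
  then show ?case by auto
qed auto

lemma cover_lift: "(u, v) \<in> adj_rel E ^^ k \<Longrightarrow> \<exists>b. ((u, a), (v, b)) \<in> cover E A ^^ k"
proof (induction k arbitrary: v)
  case (Suc k)
  then obtain w c where "((u, a), (w, c)) \<in> cover E A ^^ k" "(w, v) \<in> adj_rel E"
    by (metis relpow_Suc_E)
  then have "((u, a), (w, c)) \<in> cover E A ^^ k"
      "((w, c), (v, c \<noteq> ({w, v} \<in> A))) \<in> cover E A"
    by (auto simp: cover_def adj_rel_def)
  then show ?case by auto
qed auto

lemma relpow_segment:
  assumes "\<And>l. i \<le> l \<Longrightarrow> l < j \<Longrightarrow> (f l, f (Suc l)) \<in> R" "i \<le> j"
  shows "(f i, f j) \<in> R ^^ (j - i)"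
  using assms(2,1)
proof (induction j rule: dec_induct)
  case (step j)
  then have "(f i, f j) \<in> R ^^ (j - i)" "(f j, f (Suc j)) \<in> R" by auto
  with step(1) show ?case by (auto simp: Suc_diff_le)
qed auto

text \<open>The lower bound is the distance of \<open>i\<close> and \<open>j\<close> along a cycle
  of length \<open>L\<close>, and it is required of every walk from \<open>w i\<close> to
  \<open>w j\<close>. The case \<open>d = 0\<close> makes the vertices
  \<open>w 0, ..., w (L - 1)\<close> distinct.\<close>

definition isometric_cycle :: "'a set set \<Rightarrow> (nat \<Rightarrow> 'a) \<Rightarrow> nat \<Rightarrow> bool" where
  "isometric_cycle E w L \<longleftrightarrow> w L = w 0 \<and> (\<forall>i<L. {w i, w (Suc i)} \<in> E) \<and>
     (\<forall>i j d. i \<le> j \<and> j \<le> L \<and> (w i, w j) \<in> adj_rel E ^^ d \<longrightarrow> min (j - i) (L - (j - i)) \<le> d)"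

text \<open>Take \<open>L\<close> minimal such that some walk of length \<open>L\<close> in the
  cover joins the two points above a vertex, and project that walk. A shortcut between
  \<open>w i\<close> and \<open>w j\<close> lifts to one of the two sheets at \<open>w j\<close>,
  and on either sheet it closes up with one of the two arcs to a walk that again changes the
  sheet.\<close>

lemma odd_isometric_cycle:
  assumes "((u, False), (u, True)) \<in> (cover E A)\<^sup>*"
  obtains w L where "isometric_cycle E w L" "odd (card {i. i < L \<and> {w i, w (Suc i)} \<in> A})"
proof -
  let ?R = "cover E A"
  define L where "L = (LEAST L. \<exists>u. ((u, False), (u, True)) \<in> ?R ^^ L)"
  have L_le: "L \<le> l" if "((u, False), (u, True)) \<in> ?R ^^ l" for u l
    unfolding L_def using that by (intro Least_le) blast
  have "\<exists>u. ((u, False), (u, True)) \<in> ?R ^^ L"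
    unfolding L_def by (rule LeastI_ex) (use assms in \<open>auto simp: rtrancl_power\<close>)
  then obtain u f where f: "f 0 = (u, False)" "f L = (u, True)"
      "\<And>i. i < L \<Longrightarrow> (f i, f (Suc i)) \<in> ?R"
    unfolding relpow_fun_conv by blast
  define w where "w i = fst (f i)" for i
  have edge: "{w i, w (Suc i)} \<in> E" if "i < L" for i
    using f(3)[OF that] by (auto simp: cover_def w_def split: prod.splits)
  have seg: "(f i, f j) \<in> ?R ^^ (j - i)" if "i \<le> j" "j \<le> L" for i j
    using relpow_segment[of i j f ?R] f(3) that by auto
  have iso: "min (j - i) (L - (j - i)) \<le> d"
    if ij: "i \<le> j" "j \<le> L" and d: "(w i, w j) \<in> adj_rel E ^^ d" for i j d
  proof -
    obtain x a where x: "f i = (x, a)" by fastforce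
    obtain y b where y: "f j = (y, b)" by fastforce
    obtain b' where b': "((x, a), (y, b')) \<in> ?R ^^ d"
      using cover_lift[of x y d E a A] d by (auto simp: w_def x y)
    show ?thesis
    proof (cases "b' = b")
      \<comment> \<open>The shortcut ends at \<open>f j\<close> itself, so it can replace the arc
        from \<open>i\<close> to \<open>j\<close>. Minimality of \<open>L\<close> gives
        \<open>j - i \<le> d\<close>.\<close>
      case True
      have "(f 0, f i) \<in> ?R ^^ i" "(f j, f L) \<in> ?R ^^ (L - j)" using seg[of 0 i] seg[of j L] ij by auto
      then have "((u, False), (u, True)) \<in> ?R ^^ (i + d + (L - j))"
        unfolding relpow_add using b' True f x y by auto
      from L_le[OF this] ij show ?thesis by linarith
    next
      \<comment> \<open>The shortcut ends on the other sheet. Following the arc from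
        \<open>i\<close> to \<open>j\<close> and then the flipped shortcut backwards joins the two
        points above \<open>w i\<close>, so \<open>L \<le> j - i + d\<close>.\<close>
      case False
      have "(f i, f j) \<in> ?R ^^ (j - i)" using seg ij by simp
      with cover_flip[OF b'] False have "((x, a), (x, \<not> a)) \<in> ?R ^^ (j - i + d)"
        unfolding relpow_add x y by (cases b; cases b') (auto dest: cover_sym)
      then have "((x, False), (x, True)) \<in> ?R ^^ (j - i + d)"
        using cover_flip by (cases a) fastforce+
      from L_le[OF this] ij show ?thesis by linarith
    qed
  qed
  \<comment> \<open>The sheet at time \<open>j\<close> records the parity of the steps taken in
    \<open>A\<close>. The walk starts at \<open>False\<close> and ends at
    \<open>True\<close>.\<close>
  have "snd (f j) \<longleftrightarrow> odd (card {i. i < j \<and> {w i, w (Suc i)} \<in> A})" if "j \<le> L" for j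
    using that
  proof (induction j)
    case (Suc j)
    have "{i. i < Suc j \<and> {w i, w (Suc i)} \<in> A} =
        (if {w j, w (Suc j)} \<in> A then insert j else id) {i. i < j \<and> {w i, w (Suc i)} \<in> A}"
      by (auto simp: less_Suc_eq)
    moreover have "snd (f (Suc j)) = (snd (f j) \<noteq> ({w j, w (Suc j)} \<in> A))"
      using f(3)[of j] Suc.prems by (auto simp: cover_def w_def split: prod.splits)
    ultimately show ?case using Suc by auto
  qed (use f in simp)
  from this[of L] f have "odd (card {i. i < L \<and> {w i, w (Suc i)} \<in> A})" by simp
  moreover have "isometric_cycle E w L"
    unfolding isometric_cycle_def using iso edge f by (auto simp: w_def)
  ultimately show ?thesis by (rule that[rotated])
qed

section \<open>Long isometric cycles are not thin\<close>

lemma relpow_graph_dist: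
  assumes "(u, v) \<in> adj_rel E ^^ k"
  shows "(u, v) \<in> adj_rel E ^^ graph_dist E u v" "graph_dist E u v \<le> k"
  unfolding graph_dist_def using assms by (auto intro: LeastI Least_le)

lemma support_indicator: "support (indicator {u} :: 'a \<Rightarrow> real) = {u}"
  by (auto simp: support_def indicator_def)

text \<open>Since \<open>2 \<le> D\<close>, no edge contains both \<open>u\<close> and the support
  of \<open>g\<close>, so the minimum in \<open>point_dist\<close> applies. Each of its candidates
  is a graph distance from \<open>u\<close> plus the nonnegative amount
  \<open>1 - g x\<close>.\<close>

lemma point_dist_path_ge:
  assumes E: "E \<subseteq> vertex_pairs V"
    and far: "\<And>x. x \<in> set xs \<Longrightarrow> D \<le> graph_dist E u x" and D: "2 \<le> D"
    and g: "g \<in> path_points xs"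
  shows "real D \<le> point_dist E (indicator {u}) g"
proof -
  obtain s where s: "s \<in> (\<lambda>v. {v}) ` set xs \<union> path_edges xs" "support g \<subseteq> s" "(\<Sum>v\<in>s. g v) = 1"
    and g0: "\<And>v. 0 \<le> g v"
    using g by (auto simp: path_points_def realization_def)
  have sx: "s \<subseteq> set xs" using s(1) by (auto simp: path_edges_def)
  then have fin: "finite s" by (rule finite_subset) simp
  have g1: "g x \<le> 1" if "x \<in> s" for x
    using s(3) g0 fin that by (metis member_le_sum)
  obtain x0 where x0: "x0 \<in> support g"
    using s(3) by (metis (mono_tags, lifting) mem_Collect_eq sum.neutral support_def zero_neq_one)
  have no: "\<not> (\<exists>e\<in>E. support (indicator {u} :: 'a \<Rightarrow> real) \<union> support g \<subseteq> e)"
  proof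
    assume "\<exists>e\<in>E. support (indicator {u} :: 'a \<Rightarrow> real) \<union> support g \<subseteq> e"
    then obtain e where e: "e \<in> E" "u \<in> e" "x0 \<in> e" using x0 by (auto simp: support_indicator)
    have D': "D \<le> graph_dist E u x0" using far x0 s sx by blast
    show False
    proof (cases "u = x0")
      case True
      then have "graph_dist E u x0 \<le> 0" by (intro relpow_graph_dist(2)) simp
      with D D' show False by simp
    next
      case False
      have "card e = 2" using e E by (auto simp: vertex_pairs_def)
      with False e have "e = {u, x0}" by (auto simp: card_2_iff)
      with e have "(u, x0) \<in> adj_rel E ^^ 1" by (simp add: adj_rel_def)
      then have "graph_dist E u x0 \<le> 1" by (rule relpow_graph_dist(2))
      with D D' show False by simp
    qed
  qed
  \<comment> \<open>The lambda rebinds \<open>u\<close>, so the fixed vertex needs the second name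
    \<open>u'\<close> inside it.\<close>
  have "real D \<le> Min ((\<lambda>(u, x). (1 - indicator {u'} u) + real (graph_dist E u x) + (1 - g x)) `
                  ({u} \<times> support g))" if u': "u' = u" for u'
  proof (subst Min_ge_iff)
    show "finite ((\<lambda>(u, x). (1 - indicator {u'} u) + real (graph_dist E u x) + (1 - g x)) `
                  ({u} \<times> support g))"
      using fin s(2) finite_subset by blast
    show "\<forall>a\<in>(\<lambda>(u, x). 1 - indicator {u'} u + real (graph_dist E u x) + (1 - g x)) ` ({u} \<times> support g). real D \<le> a"
    proof
      fix a assume "a \<in> (\<lambda>(u, x). 1 - indicator {u'} u + real (graph_dist E u x) + (1 - g x)) ` ({u} \<times> support g)"
      then obtain x where x: "x \<in> support g" "a = real (graph_dist E u x) + (1 - g x)"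
        using u' by auto
      have "D \<le> graph_dist E u x" "g x \<le> 1" using far g1 x s sx by blast+
      with x show "real D \<le> a" by simp
    qed
  qed (use x0 in auto)
  from this[OF refl] show ?thesis
    unfolding point_dist_def unfolding if_not_P[OF no] unfolding support_indicator .
qed

text \<open>The triangle has its vertices at the positions \<open>0\<close>, \<open>m\<close> and
  \<open>2 * m\<close> of the cycle, with \<open>m\<close> about \<open>L / 3\<close>. Its sides are
  arcs no longer than half of the cycle, hence shortest paths. The vertex \<open>w h\<close>, near
  the middle of the first side, is far from the two others.\<close>

lemma isometric_cycle_not_hyperbolic:
  assumes E: "E \<subseteq> vertex_pairs V" and iso: "isometric_cycle E w L"
    and L: "2 \<le> L div 6" "\<delta> < real (L div 6)"
  shows "\<not> hyperbolic V E \<delta>"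
proof
  assume hyp: "hyperbolic V E \<delta>"
  define m where "m = L div 3"
  define h where "h = L div 6"
  \<comment> \<open>The third arc has length \<open>L - 2 * m\<close>, up to \<open>m + 2\<close>.
    It is at most \<open>L / 2\<close> because \<open>L \<le> 3 * m + 2 \<le> 4 * m\<close>.\<close>
  have m: "2 \<le> m" "2 * h \<le> m" "m \<le> 2 * h + 1" "3 * m \<le> L" "L \<le> 3 * m + 2" using L by (auto simp: m_def h_def)
  have edge: "\<And>i. i < L \<Longrightarrow> {w i, w (Suc i)} \<in> E" and wL: "w L = w 0"
    and lower: "\<And>i j d. i \<le> j \<Longrightarrow> j \<le> L \<Longrightarrow> (w i, w j) \<in> adj_rel E ^^ d \<Longrightarrow> min (j - i) (L - (j - i)) \<le> d"
    using iso by (auto simp: isometric_cycle_def)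
  have arc: "(w i, w j) \<in> adj_rel E ^^ (j - i)" if "i \<le> j" "j \<le> L" for i j
    by (rule relpow_segment) (use that edge in \<open>auto simp: adj_rel_def\<close>)
  have dist: "min (j - i) (L - (j - i)) \<le> graph_dist E (w i) (w j)" if "i \<le> j" "j \<le> L" for i j
    using lower[OF that] relpow_graph_dist(1)[OF arc[OF that]] by blast
  have wV: "w i \<in> V" if "i \<le> L" for i
  proof (cases "i = L")
    case True
    then show ?thesis using edge_mem[OF E edge[of 0]] wL L by (cases L) auto
  next
    case False
    then show ?thesis using edge_mem[OF E edge[of i]] that by auto
  qed
  define p where "p i j = map w [i..<Suc j]" for i j
  have sp: "shortest_path E (w i) (w j) (p i j)" if "i \<le> j" "j \<le> L" "2 * (j - i) \<le> L" for i j
  proof -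
    have "graph_dist E (w i) (w j) = j - i"
      using dist[OF that(1,2)] relpow_graph_dist(2)[OF arc[OF that(1,2)]] that(3) by linarith
    moreover have "successively (\<lambda>x y. {x, y} \<in> E) (p i j)"
      unfolding p_def successively_conv_nth
    proof (intro allI impI)
      fix l assume l: "Suc l < length (map w [i..<Suc j])"
      then show "{map w [i..<Suc j] ! l, map w [i..<Suc j] ! Suc l} \<in> E"
        using edge[of "i + l"] that by (simp del: upt_Suc)
    qed
    ultimately show ?thesis
      using that unfolding shortest_path_def p_def by (auto simp: hd_map last_map Suc_diff_le simp del: upt_Suc)
  qed
  have set_p: "set (p i j) = w ` {i..j}" for i j by (auto simp: p_def simp del: upt_Suc)
  have "thin_triangle V E \<delta> (p 0 m) (p m (2 * m)) (p (2 * m) L)"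
    using hyp sp[of 0 m] sp[of m "2 * m"] sp[of "2 * m" L] m wV[of 0] wV[of m] wV[of "2 * m"] wL
    unfolding hyperbolic_def by auto
  moreover have "indicator {w h} \<in> path_points (p 0 m)"
  proof -
    have "w h \<in> set (p 0 m)" using m by (auto simp: set_p)
    then show ?thesis unfolding path_points_def realization_def
      by (auto simp: support_indicator intro!: bexI[of _ "{w h}"])
  qed
  ultimately obtain g i j where g: "g \<in> path_points (p i j)" "m \<le> i" "j \<le> L"
      and d: "point_dist E (indicator {w h}) g \<le> \<delta>"
  proof -
    assume that: "\<And>g i j. g \<in> path_points (p i j) \<Longrightarrow> m \<le> i \<Longrightarrow> j \<le> L \<Longrightarrow>
      point_dist E (indicator {w h}) g \<le> \<delta> \<Longrightarrow> thesis"
    assume "thin_triangle V E \<delta> (p 0 m) (p m (2 * m)) (p (2 * m) L)"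
      "indicator {w h} \<in> path_points (p 0 m)"
    then consider g where "g \<in> path_points (p m (2 * m))" "point_dist E (indicator {w h}) g \<le> \<delta>"
      | g where "g \<in> path_points (p (2 * m) L)" "point_dist E (indicator {w h}) g \<le> \<delta>"
      unfolding thin_triangle_def nbhd_def by blast
    then show thesis by cases (use that m in auto)
  qed
  have "real h \<le> point_dist E (indicator {w h}) g"
  \<comment> \<open>A vertex of the other sides is \<open>w l\<close> with
    \<open>m \<le> l \<le> L\<close>. From \<open>h\<close>, going up takes at least
    \<open>m - h \<ge> h\<close> steps, and going down through \<open>w 0 = w L\<close> takes at
    least \<open>h\<close>.\<close>
  proof (rule point_dist_path_ge[OF E _ _ g(1)])
    fix x assume "x \<in> set (p i j)"
    then obtain l where l: "x = w l" "i \<le> l" "l \<le> j" by (auto simp: set_p)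
    then show "h \<le> graph_dist E (w h) x" using dist[of h l] m g by auto
  qed (use L in \<open>simp add: h_def\<close>)
  with d L show False by (simp add: h_def)
qed


section \<open>Few short cycles and many independent cycles\<close>

text \<open>A cycle of length \<open>l\<close> appears as \<open>2 * l\<close> lists, one for each
  starting vertex and direction. This overcount is harmless because only upper bounds on the number
  of short cycles enter.\<close>

definition short_cycles :: "'a set set \<Rightarrow> nat \<Rightarrow> 'a list set" where
  "short_cycles E K = {xs. distinct xs \<and> 3 \<le> length xs \<and> length xs \<le> K \<and>
     (\<forall>i<length xs. {xs ! i, xs ! (Suc i mod length xs)} \<in> E)}"

lemma short_cycles_mono: "E \<subseteq> F \<Longrightarrow> short_cycles E K \<subseteq> short_cycles F K"
  by (auto simp: short_cycles_def)

lemma short_cycles_subset: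
  assumes "E \<subseteq> vertex_pairs V" "xs \<in> short_cycles E K"
  shows "set xs \<subseteq> V"
proof
  fix x assume "x \<in> set xs"
  then obtain i where "i < length xs" "x = xs ! i" by (metis in_set_conv_nth)
  with assms(2) edge_mem[OF assms(1)] show "x \<in> V" unfolding short_cycles_def by blast
qed

lemma finite_short_cycles:
  assumes "finite V" "E \<subseteq> vertex_pairs V"
  shows "finite (short_cycles E K)"
proof (rule finite_subset)
  show "short_cycles E K \<subseteq> {xs. set xs \<subseteq> V \<and> length xs \<le> K}"
    using short_cycles_subset[OF assms(2)] by (auto simp: short_cycles_def)
qed (rule finite_lists_length_le[OF assms(1)])

text \<open>Linear algebra over the field with two elements, by the pigeonhole principle.\<close>

lemma even_transversal:
  fixes g :: "'q \<Rightarrow> nat \<Rightarrow> 'e"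
  assumes "finite D" "finite Q" "card Q < card D"
  obtains A where "A \<subseteq> D" "A \<noteq> {}" "\<And>q. q \<in> Q \<Longrightarrow> even (card {i. i < l q \<and> g q i \<in> A})"
proof -
  \<comment> \<open>There are \<open>2 ^ card D\<close> sets \<open>A\<close> but at most
    \<open>2 ^ card Q\<close> values of this parity map. Two sets with the same value have a
    symmetric difference that every \<open>q\<close> meets evenly.\<close>
  define \<Phi> where "\<Phi> A = {q \<in> Q. odd (card {i. i < l q \<and> g q i \<in> A})}" for A
  have "\<not> inj_on \<Phi> (Pow D)"
  proof
    assume "inj_on \<Phi> (Pow D)"
    then have "card (Pow D) \<le> card (Pow Q)"
      using assms by (intro card_inj_on_le[of \<Phi>]) (auto simp: \<Phi>_def)
    with assms show False by (simp add: card_Pow)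
  qed
  then obtain A B where AB: "A \<subseteq> D" "B \<subseteq> D" "A \<noteq> B" "\<Phi> A = \<Phi> B"
    by (auto simp: inj_on_def)
  show ?thesis
  proof
    show "(A - B) \<union> (B - A) \<subseteq> D" "(A - B) \<union> (B - A) \<noteq> {}" using AB by auto
    fix q assume q: "q \<in> Q"
    define I where "I C = {i. i < l q \<and> g q i \<in> C}" for C
    have fin: "finite (I C)" for C by (simp add: I_def)
    have "card (I A) + card (I B) = card (I (A - B)) + card (I (B - A)) + 2 * card (I (A \<inter> B))"
    proof -
      have "I A = I (A - B) \<union> I (A \<inter> B)" "I B = I (B - A) \<union> I (A \<inter> B)" by (auto simp: I_def)
      moreover have "I (A - B) \<inter> I (A \<inter> B) = {}" "I (B - A) \<inter> I (A \<inter> B) = {}" by (auto simp: I_def)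
      ultimately show ?thesis using fin by (simp add: card_Un_disjoint)
    qed
    moreover have "even (card (I A)) \<longleftrightarrow> even (card (I B))" using AB(4) q by (auto simp: \<Phi>_def I_def)
    moreover have "card (I ((A - B) \<union> (B - A))) = card (I (A - B)) + card (I (B - A))"
    proof -
      have "I ((A - B) \<union> (B - A)) = I (A - B) \<union> I (B - A)" "I (A - B) \<inter> I (B - A) = {}"
        by (auto simp: I_def)
      then show ?thesis using fin by (simp add: card_Un_disjoint)
    qed
    ultimately have "even (card (I ((A - B) \<union> (B - A))))" by presburger
    then show "even (card {i. i < l q \<and> g q i \<in> (A - B) \<union> (B - A)})" by (simp add: I_def)
  qed
qed

lemma cover_avoiding:
  assumes "(u, v) \<in> (adj_rel T)\<^sup>*" "T \<subseteq> E" "A \<inter> T = {}"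
  shows "((u, a), (v, a)) \<in> (cover E A)\<^sup>*"
  using assms(1)
proof (induction rule: rtrancl_induct)
  case (step v w)
  then have "((v, a), (w, a)) \<in> cover E A" using assms by (auto simp: cover_def adj_rel_def)
  with step.IH show ?case by simp
qed simp

text \<open>The set \<open>A\<close> of non-tree edges is chosen to meet every short cycle evenly.
  The fundamental cycle of an edge of \<open>A\<close> meets \<open>A\<close> only in that edge, so
  odd closed walks exist. A shortest one is isometric and, being odd, cannot be short.\<close>

lemma few_short_cycles_not_hyperbolic:
  assumes V: "finite V" and E: "E \<subseteq> vertex_pairs V" and T: "T \<subseteq> E"
    and conn: "\<And>v. v \<in> V \<Longrightarrow> (r, v) \<in> (adj_rel T)\<^sup>*"
    and few: "card (short_cycles E K) < card (E - T)"
    and K: "12 \<le> K" "\<And>L. K < L \<Longrightarrow> \<delta> < real (L div 6)"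
  shows "\<not> hyperbolic V E \<delta>"
proof -
  have "finite (E - T)" using finite_vertex_pairs[OF V] E finite_subset by blast
  then obtain A where A: "A \<subseteq> E - T" "A \<noteq> {}"
    and even: "\<And>xs. xs \<in> short_cycles E K \<Longrightarrow>
      even (card {i. i < length xs \<and> {xs ! i, xs ! (Suc i mod length xs)} \<in> A})"
    by (rule even_transversal[OF _ finite_short_cycles[OF V E] few,
          of length "\<lambda>xs i. {xs ! i, xs ! (Suc i mod length xs)}"]) blast
  obtain e where e: "e \<in> A" using A by blast
  then have "card e = 2" using A E by (auto simp: vertex_pairs_def)
  then obtain x y where xy: "e = {x, y}" by (auto simp: card_2_iff)
  have xyV: "x \<in> V" "y \<in> V" using edge_mem[OF E, of x y] A e xy by auto
  have sym: "sym ((adj_rel T)\<^sup>*)" by (rule sym_rtrancl[OF sym_adj_rel])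
  have "(y, x) \<in> (adj_rel T)\<^sup>*"
    using conn[OF xyV(1)] symD[OF sym conn[OF xyV(2)]] by (meson rtrancl_trans)
  \<comment> \<open>The tree path back from \<open>y\<close> to \<open>x\<close> avoids
    \<open>A\<close> and stays on its sheet; only the edge \<open>e\<close> changes it.\<close>
  then have "((y, True), (x, True)) \<in> (cover E A)\<^sup>*" using A T by (intro cover_avoiding) auto
  moreover have "((x, False), (y, True)) \<in> cover E A" using e A xy by (auto simp: cover_def)
  ultimately have "((x, False), (x, True)) \<in> (cover E A)\<^sup>*" by simp
  then obtain w L where iso: "isometric_cycle E w L"
    and odd: "odd (card {i. i < L \<and> {w i, w (Suc i)} \<in> A})"
    by (rule odd_isometric_cycle)
  have edge: "\<And>i. i < L \<Longrightarrow> {w i, w (Suc i)} \<in> E" and wL: "w L = w 0"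
    and lower: "\<And>i j d. i \<le> j \<Longrightarrow> j \<le> L \<Longrightarrow> (w i, w j) \<in> adj_rel E ^^ d \<Longrightarrow> min (j - i) (L - (j - i)) \<le> d"
    using iso by (auto simp: isometric_cycle_def)
  have "K < L"
  proof (rule ccontr)
    assume "\<not> K < L"
    define xs where "xs = map w [0..<L]"
    have nth: "xs ! i = w i" "xs ! (Suc i mod length xs) = w (Suc i)" if "i < L" for i
      using that wL by (auto simp: xs_def mod_Suc)
    have len: "length xs = L" by (simp add: xs_def)
    \<comment> \<open>It remains to rule out the degenerate closed walks: length \<open>0\<close> is
      even, length \<open>1\<close> would be a loop, and length \<open>2\<close> runs through one
      edge twice and is even.\<close>
    have "L \<noteq> 0" using odd by (cases L) auto
    moreover have "L \<noteq> 1" using edge[of 0] wL edge_neq[OF E, of "w 0" "w 1"] by auto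
    moreover have "L \<noteq> 2"
    proof
      assume L: "L = 2"
      have "{w i, w (Suc i)} = {w 0, w 1}" if "i < L" for i
      proof -
        have "i = 0 \<or> i = 1" using that L by auto
        then show ?thesis using wL L by (auto simp: numeral_2_eq_2)
      qed
      then have "{i. i < L \<and> {w i, w (Suc i)} \<in> A} = {i. i < L \<and> {w 0, w 1} \<in> A}"
        by (intro Collect_cong conj_cong refl) metis
      with odd L show False by (cases "{w 0, w 1} \<in> A") simp_all
    qed
    moreover have "distinct xs"
    proof -
      have "w i \<noteq> w j" if "i < j" "j < L" for i j
        using lower[of i j 0] that by auto
      then show ?thesis unfolding xs_def distinct_conv_nth by (auto simp: neq_iff) metis
    qed
    ultimately have "xs \<in> short_cycles E K"
      using \<open>\<not> K < L\<close> edge nth by (auto simp: short_cycles_def len)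
    from even[OF this] have "even (card {i. i < L \<and> {w i, w (Suc i)} \<in> A})"
      using nth by (simp add: len cong: conj_cong)
    with odd show False by simp
  qed
  then show ?thesis
    using isometric_cycle_not_hyperbolic[OF E iso _ K(2)] K(1) by auto
qed


section \<open>First-moment bounds\<close>

lemma finite_vp: "finite (vertex_pairs {1..n::nat})"
  by (rule finite_vertex_pairs) simp

lemma set_pmf_gnp: "set_pmf (gnp n p) \<subseteq> Pow (vertex_pairs {1..n})"
  by (auto simp: gnp_def)

text \<open>By independence the probability factors over the vertex pairs; pairs outside
  \<open>P\<close> and \<open>N\<close> contribute the factor \<open>1\<close>.\<close>

lemma gnp_le:
  assumes p: "0 \<le> p" "p \<le> 1" and P: "finite P"
    and N: "N \<subseteq> vertex_pairs {1..n}" "P \<inter> N = {}"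
  shows "measure_pmf.prob (gnp n p) {E. P \<subseteq> E \<and> N \<inter> E = {}} \<le> p ^ card P * (1 - p) ^ card N"
proof (cases "P \<subseteq> vertex_pairs {1..n}")
  \<comment> \<open>This case occurs when \<open>P\<close> comes from a parent map with a fixed
    point \<open>v\<close>, which yields the singleton \<open>{v}\<close>. No edge set contains such
    a \<open>P\<close>.\<close>
  case False
  then have "measure_pmf.prob (gnp n p) {E. P \<subseteq> E \<and> N \<inter> E = {}} = 0"
    using set_pmf_gnp[of n p] by (subst measure_pmf_zero_iff) auto
  then show ?thesis using p by simp
next
  case True
  let ?VP = "vertex_pairs {1..n}"
  define B where "B e = (if e \<in> P then {True} else if e \<in> N then {False} else UNIV)" for e
  have "(\<lambda>\<omega>. {e \<in> ?VP. \<omega> e}) -` {E. P \<subseteq> E \<and> N \<inter> E = {}} \<subseteq> Pi ?VP B"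
    using True N by (auto simp: B_def Pi_def)
  then have "measure_pmf.prob (gnp n p) {E. P \<subseteq> E \<and> N \<inter> E = {}}
      \<le> measure_pmf.prob (Pi_pmf ?VP False (\<lambda>_. bernoulli_pmf p)) (Pi ?VP B)"
    unfolding gnp_def measure_map_pmf by (intro measure_pmf.finite_measure_mono) auto
  also have "\<dots> = (\<Prod>e\<in>?VP. measure_pmf.prob (bernoulli_pmf p) (B e))"
    by (rule measure_Pi_pmf_Pi[OF finite_vp])
  also have "\<dots> = (\<Prod>e\<in>?VP. (if e \<in> P then p else 1) * (if e \<in> N then 1 - p else 1))"
    using p N by (intro prod.cong) (auto simp: B_def measure_pmf_single)
  also have "\<dots> = p ^ card P * (1 - p) ^ card N"
    using True N finite_vp[of n] finite_subset[OF True] by (simp add: prod.distrib prod.If_cases Int_absorb1)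
  finally show ?thesis .
qed

text \<open>Intersecting with the support allows the covering to be checked on genuine edge sets
  only.\<close>

lemma union_bound:
  assumes "finite I" "\<And>i. i \<in> I \<Longrightarrow> measure_pmf.prob M (A i) \<le> b" "X \<inter> set_pmf M \<subseteq> (\<Union>i\<in>I. A i)"
  shows "measure_pmf.prob M X \<le> real (card I) * b"
proof -
  have "measure_pmf.prob M X = measure_pmf.prob M (X \<inter> set_pmf M)"
    by (simp add: measure_Int_set_pmf)
  also have "\<dots> \<le> measure_pmf.prob M (\<Union>i\<in>I. A i)"
    using assms by (intro measure_pmf.finite_measure_mono) auto
  also have "\<dots> \<le> (\<Sum>i\<in>I. measure_pmf.prob M (A i))"
    using assms by (intro measure_pmf.finite_measure_subadditive_finite) auto
  also have "\<dots> \<le> (\<Sum>i\<in>I. b)" by (rule sum_mono) (rule assms)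
  finally show ?thesis by simp
qed

section \<open>Exploration of the components of the first vertices\<close>

definition cut_edges :: "'a set \<Rightarrow> 'a set \<Rightarrow> 'a set set" where
  "cut_edges V S = (\<lambda>(u, v). {u, v}) ` (S \<times> (V - S))"

lemma cut_edges_subset: "S \<subseteq> V \<Longrightarrow> cut_edges V S \<subseteq> vertex_pairs V"
  by (auto simp: cut_edges_def vertex_pairs_def card_2_iff)

lemma card_cut_edges:
  assumes "S \<subseteq> V" "finite V"
  shows "card (cut_edges V S) = card S * (card V - card S)"
proof -
  have "inj_on (\<lambda>(u, v). {u, v}) (S \<times> (V - S))" by (auto simp: inj_on_def doubleton_eq_iff)
  then show ?thesis
    using assms by (simp add: cut_edges_def card_image card_cartesian_product card_Diff_subset finite_subset)
qed

definition reached :: "nat \<Rightarrow> nat set set \<Rightarrow> nat \<Rightarrow> nat set" where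
  "reached n E j = {v \<in> {1..n}. \<exists>r\<in>{1..j}. (r, v) \<in> (adj_rel E)\<^sup>*}"

lemma reached_subset: "reached n E j \<subseteq> {1..n}"
  by (auto simp: reached_def)

lemma reached_closed:
  assumes "E \<subseteq> vertex_pairs {1..n}" "{u, v} \<in> E" "v \<in> reached n E j"
  shows "u \<in> reached n E j"
proof -
  have "(v, u) \<in> adj_rel E" using assms(2) by (simp add: adj_rel_def insert_commute)
  then show ?thesis
    using assms edge_mem[OF assms(1,2)] unfolding reached_def by (blast intro: rtrancl.rtrancl_into_rtrancl)
qed

text \<open>Union bound over the reached set \<open>S\<close>, which is determined by
  \<open>S - {1..j}\<close>, and over the parent maps of a forest on \<open>S\<close> rooted in
  \<open>{1..j}\<close>. The \<open>k - j\<close> forest edges are present and the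
  \<open>k * (n - k)\<close> edges leaving \<open>S\<close> are absent.\<close>

lemma prob_card_reached_le:
  assumes p: "0 \<le> p" "p \<le> 1" and j: "j \<le> n" "j \<le> k"
  shows "measure_pmf.prob (gnp n p) {E. card (reached n E j) = k} \<le>
    real (n choose (k - j)) * real k ^ (k - j) * (p ^ (k - j) * (1 - p) ^ (k * (n - k)))"
proof -
  define \<S> where "\<S> = {S. {1..j} \<subseteq> S \<and> S \<subseteq> {1..n} \<and> card S = k}"
  define F where "F S = (S - {1..j}) \<rightarrow>\<^sub>E S" for S :: "nat set"
  define T where "T S f = (\<lambda>v. {v, f v}) ` (S - {1..j})" for S :: "nat set" and f
  have fin\<S>: "finite \<S>" by (rule finite_subset[of _ "Pow {1..n}"]) (auto simp: \<S>_def)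
  have S: "finite S" "card (S - {1..j}) = k - j" if "S \<in> \<S>" for S
    using that finite_subset[of S "{1..n}"] by (auto simp: \<S>_def card_Diff_subset)
  \<comment> \<open>Only maps with pairwise distinct edges are kept, so that exactly
    \<open>k - j\<close> edges are prescribed.\<close>
  define I where "I = {(S, f) \<in> Sigma \<S> F. inj_on (\<lambda>v. {v, f v}) (S - {1..j})}"
  have finF: "finite (F S)" if "S \<in> \<S>" for S using S[OF that] by (auto simp: F_def intro!: finite_PiE)
  have finI: "finite (Sigma \<S> F)" using fin\<S> finF by auto
  have card\<S>: "card \<S> \<le> n choose (k - j)"
  proof -
    have "card \<S> \<le> card {S. S \<subseteq> {1..n} \<and> card S = k - j}"
    proof (rule card_inj_on_le[of "\<lambda>S. S - {1..j}"])
      show "inj_on (\<lambda>S. S - {1..j}) \<S>" by (rule inj_onI) (auto simp: \<S>_def)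
      show "(\<lambda>S. S - {1..j}) ` \<S> \<subseteq> {S. S \<subseteq> {1..n} \<and> card S = k - j}" using S by (auto simp: \<S>_def)
    qed simp
    then show ?thesis by (simp add: n_subsets)
  qed
  have "card I \<le> card (Sigma \<S> F)" by (rule card_mono[OF finI]) (auto simp: I_def)
  also have "\<dots> = (\<Sum>S\<in>\<S>. card (F S))" using fin\<S> finF by (simp add: card_SigmaI)
  also have "\<dots> = (\<Sum>S\<in>\<S>. k ^ (k - j))"
    using S by (intro sum.cong refl) (auto simp: F_def card_PiE \<S>_def)
  also have "\<dots> \<le> (n choose (k - j)) * k ^ (k - j)" using card\<S> by simp
  finally have cardI: "card I \<le> (n choose (k - j)) * k ^ (k - j)" .
  have "measure_pmf.prob (gnp n p) {E. card (reached n E j) = k} \<le>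
      real (card I) * (p ^ (k - j) * (1 - p) ^ (k * (n - k)))"
  proof (rule union_bound[where A = "\<lambda>(S, f). {E. T S f \<subseteq> E \<and> cut_edges {1..n} S \<inter> E = {}}"])
    show "finite I" by (rule finite_subset[OF _ finI]) (auto simp: I_def)
    fix x assume "x \<in> I"
    then obtain S f where x: "x = (S, f)" "S \<in> \<S>" "f \<in> F S" "inj_on (\<lambda>v. {v, f v}) (S - {1..j})"
      by (auto simp: I_def)
    have "T S f \<subseteq> Pow S" using x(3) by (auto simp: T_def F_def)
    moreover have "Pow S \<inter> cut_edges {1..n} S = {}" by (auto simp: cut_edges_def)
    ultimately have "T S f \<inter> cut_edges {1..n} S = {}" by blast
    moreover have "card (T S f) = k - j" using x S by (simp add: T_def card_image)
    moreover have "card (cut_edges {1..n} S) = k * (n - k)"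
      using x by (subst card_cut_edges) (auto simp: \<S>_def)
    moreover have "finite (T S f)" using S x by (simp add: T_def)
    moreover have "cut_edges {1..n} S \<subseteq> vertex_pairs {1..n}" using x by (intro cut_edges_subset) (auto simp: \<S>_def)
    ultimately show "measure_pmf.prob (gnp n p) (case x of (S, f) \<Rightarrow> {E. T S f \<subseteq> E \<and> cut_edges {1..n} S \<inter> E = {}})
        \<le> p ^ (k - j) * (1 - p) ^ (k * (n - k))"
      using gnp_le[OF p, of "T S f" "cut_edges {1..n} S" n] x by simp
  next
    show "{E. card (reached n E j) = k} \<inter> set_pmf (gnp n p) \<subseteq>
      (\<Union>i\<in>I. case i of (S, f) \<Rightarrow> {E. T S f \<subseteq> E \<and> cut_edges {1..n} S \<inter> E = {}})"
    proof
      fix E assume "E \<in> {E. card (reached n E j) = k} \<inter> set_pmf (gnp n p)"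
      then have E: "E \<subseteq> vertex_pairs {1..n}" "card (reached n E j) = k" using set_pmf_gnp by auto
      let ?S = "reached n E j"
      have roots: "\<exists>r\<in>{1..j}. (r, v) \<in> (adj_rel E)\<^sup>*" if "v \<in> ?S" for v
        using that by (simp add: reached_def)
      obtain f where f: "f \<in> ?S - {1..j} \<rightarrow>\<^sub>E ?S" "\<And>v. v \<in> ?S - {1..j} \<Longrightarrow> {v, f v} \<in> E"
        "inj_on (\<lambda>v. {v, f v}) (?S - {1..j})"
        by (rule spanning_forest[of ?S "{1..j}" E]) (erule roots, erule (1) reached_closed[OF E(1)], blast)
      have "?S \<in> \<S>" using E(2) j by (auto simp: \<S>_def reached_def)
      with f have "(?S, f) \<in> I" by (auto simp: I_def F_def)
      moreover have "T ?S f \<subseteq> E" using f by (auto simp: T_def)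
      moreover have "cut_edges {1..n} ?S \<inter> E = {}"
        by (auto simp: cut_edges_def) (metis insert_commute reached_closed[OF E(1)])
      ultimately show "E \<in> (\<Union>i\<in>I. case i of (S, f) \<Rightarrow> {E. T S f \<subseteq> E \<and> cut_edges {1..n} S \<inter> E = {}})"
        by blast
    qed
  qed
  also have "\<dots> \<le> real ((n choose (k - j)) * k ^ (k - j)) * (p ^ (k - j) * (1 - p) ^ (k * (n - k)))"
    using cardI p by (intro mult_right_mono of_nat_mono) auto
  finally show ?thesis by simp
qed

section \<open>Components with few edges outside a spanning tree\<close>

lemma card_small_subsets_le:
  assumes "finite X" "card X \<le> b" "1 \<le> b"
  shows "finite {F. F \<subseteq> X \<and> card F \<le> M}" "card {F. F \<subseteq> X \<and> card F \<le> M} \<le> Suc M * b ^ M"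
proof -
  let ?L = "{xs. set xs \<subseteq> X \<and> length xs \<le> M}"
  have fin: "finite ?L" by (rule finite_lists_length_le[OF assms(1)])
  have "{F. F \<subseteq> X \<and> card F \<le> M} \<subseteq> set ` ?L"
  proof
    fix F assume F: "F \<in> {F. F \<subseteq> X \<and> card F \<le> M}"
    then obtain xs where "set xs = F" "distinct xs"
      using finite_distinct_list[of F] finite_subset[OF _ assms(1)] by blast
    with F show "F \<in> set ` ?L" using distinct_card by fastforce
  qed
  then have "card {F. F \<subseteq> X \<and> card F \<le> M} \<le> card (set ` ?L)"
    by (rule card_mono[OF finite_imageI[OF fin]])
  also have "\<dots> \<le> card ?L" by (rule card_image_le[OF fin])
  also have "card ?L = (\<Sum>i\<le>M. card X ^ i)" by (rule card_lists_length_le[OF assms(1)])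
  also have "\<dots> \<le> (\<Sum>i\<le>M. b ^ M)"
  proof (rule sum_mono)
    fix i assume "i \<in> {..M}"
    then have "card X ^ i \<le> b ^ i" "b ^ i \<le> b ^ M"
      using assms by (auto intro: power_mono power_increasing)
    then show "card X ^ i \<le> b ^ M" by simp
  qed
  finally show "card {F. F \<subseteq> X \<and> card F \<le> M} \<le> Suc M * b ^ M" by simp
qed (use assms(1) in simp)

text \<open>A spanning tree rooted at \<open>r\<close> is encoded by its parent map
  \<open>f\<close>. Only distinctness of the \<open>k - 1\<close> edges is imposed, not acyclicity;
  the event becomes larger, which is the right direction for an upper bound.\<close>

definition tree_like :: "nat \<Rightarrow> nat \<Rightarrow> nat \<Rightarrow> nat set set \<Rightarrow> bool" where
  "tree_like n M k E \<longleftrightarrow> (\<exists>S r f. S \<subseteq> {1..n} \<and> card S = k \<and> cut_edges {1..n} S \<inter> E = {} \<and>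
     r \<in> S \<and> f \<in> S - {r} \<rightarrow>\<^sub>E S \<and> inj_on (\<lambda>v. {v, f v}) (S - {r}) \<and>
     (\<lambda>v. {v, f v}) ` (S - {r}) \<subseteq> E \<and>
     card (induced_edges E S - (\<lambda>v. {v, f v}) ` (S - {r})) \<le> M)"

text \<open>Union bound over \<open>S\<close>, the root, the parent map and the set \<open>F\<close>
  of at most \<open>M\<close> extra edges. Once these are fixed, the tree edges are present, while
  the cut edges and all other pairs inside \<open>S\<close> are absent.\<close>

lemma prob_tree_like_le:
  assumes p: "0 \<le> p" "p \<le> 1" and n: "1 \<le> n"
  shows "measure_pmf.prob (gnp n p) {E. tree_like n M k E} \<le>
    real ((n choose k) * (k * k ^ (k - 1)) * (Suc M * (n ^ 2) ^ M)) *
      (p ^ (k - 1) * (1 - p) ^ (k * (n - k) + ((k choose 2) - (k - 1) - M)))"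
proof -
  define \<S> where "\<S> = {S. S \<subseteq> {1..n} \<and> card S = k}"
  define \<F> where "\<F> = {F. F \<subseteq> vertex_pairs {1..n} \<and> card F \<le> M}"
  define T where "T S r f = (\<lambda>v. {v, f v}) ` (S - {r})" for S :: "nat set" and r f
  define N where "N S r f F = cut_edges {1..n} S \<union> (vertex_pairs S - T S r f - F)" for S r f F
  define J where "J = Sigma \<S> (\<lambda>S. Sigma S (\<lambda>r. (S - {r}) \<rightarrow>\<^sub>E S))"
  define I where "I = {((S, r, f), F). ((S, r, f), F) \<in> J \<times> \<F> \<and> inj_on (\<lambda>v. {v, f v}) (S - {r})}"
  have fin\<S>: "finite \<S>" by (rule finite_subset[of _ "Pow {1..n}"]) (auto simp: \<S>_def)
  have S: "finite S" "card S = k" "S \<subseteq> {1..n}" if "S \<in> \<S>" for S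
    using that finite_subset[of S "{1..n}"] by (auto simp: \<S>_def)
  have finPi: "finite ((S - {r}) \<rightarrow>\<^sub>E S)" if "S \<in> \<S>" for S and r :: nat
    using S[OF that] by (intro finite_PiE) auto
  have finSig: "finite (Sigma S (\<lambda>r. (S - {r}) \<rightarrow>\<^sub>E S))" if "S \<in> \<S>" for S
    using S[OF that] finPi[OF that] by (intro finite_SigmaI) auto
  have finJ: "finite J" unfolding J_def by (rule finite_SigmaI[OF fin\<S> finSig])
  have "card J = (\<Sum>S\<in>\<S>. card (Sigma S (\<lambda>r. (S - {r}) \<rightarrow>\<^sub>E S)))"
    unfolding J_def using fin\<S> finSig by (intro card_SigmaI) auto
  also have "\<dots> = (\<Sum>S\<in>\<S>. k * k ^ (k - 1))"
  proof (rule sum.cong[OF refl])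
    fix S assume "S \<in> \<S>"
    note S = S[OF this] finPi[OF this]
    have "card (Sigma S (\<lambda>r. (S - {r}) \<rightarrow>\<^sub>E S)) = (\<Sum>r\<in>S. card ((S - {r}) \<rightarrow>\<^sub>E S))"
      using S by (intro card_SigmaI) auto
    also have "\<dots> = (\<Sum>r\<in>S. k ^ (k - 1))"
      using S by (intro sum.cong refl) (simp add: card_PiE)
    finally show "card (Sigma S (\<lambda>r. (S - {r}) \<rightarrow>\<^sub>E S)) = k * k ^ (k - 1)" using S by simp
  qed
  finally have cardJ: "card J = (n choose k) * (k * k ^ (k - 1))"
    unfolding \<S>_def by (simp add: n_subsets)
  have card_vp: "card (vertex_pairs {1..n}) \<le> n ^ 2"
  proof -
    have "card (vertex_pairs {1..n}) = n choose 2" by (simp add: vertex_pairs_def n_subsets)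
    also have "\<dots> \<le> n ^ 2" by (simp add: choose_two power2_eq_square div_le_mono order_trans[OF div_le_dividend])
    finally show ?thesis .
  qed
  have fin\<F>: "finite \<F>" and card\<F>: "card \<F> \<le> Suc M * (n ^ 2) ^ M"
    using card_small_subsets_le[OF finite_vp card_vp] n by (auto simp: \<F>_def)
  have "card I \<le> card (J \<times> \<F>)"
    using finJ fin\<F> by (intro card_mono) (auto simp: I_def)
  also have "\<dots> \<le> (n choose k) * (k * k ^ (k - 1)) * (Suc M * (n ^ 2) ^ M)"
    unfolding card_cartesian_product cardJ using card\<F> by (rule mult_left_mono) simp
  finally have cardI: "card I \<le> (n choose k) * (k * k ^ (k - 1)) * (Suc M * (n ^ 2) ^ M)" .
  let ?b = "p ^ (k - 1) * (1 - p) ^ (k * (n - k) + ((k choose 2) - (k - 1) - M))"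
  have "measure_pmf.prob (gnp n p) {E. tree_like n M k E} \<le> real (card I) * ?b"
  proof (rule union_bound[where A = "\<lambda>((S, r, f), F). {E. T S r f \<subseteq> E \<and> N S r f F \<inter> E = {}}"])
    show "finite I" using finJ fin\<F> by (intro finite_subset[of I "J \<times> \<F>"]) (auto simp: I_def)
    fix x assume "x \<in> I"
    then obtain S r f F where x: "x = ((S, r, f), F)" "S \<in> \<S>" "r \<in> S" "f \<in> (S - {r}) \<rightarrow>\<^sub>E S" "F \<in> \<F>"
      "inj_on (\<lambda>v. {v, f v}) (S - {r})" by (auto simp: I_def J_def)
    note S = S[OF x(2)]
    have cut: "Pow S \<inter> cut_edges {1..n} S = {}" by (auto simp: cut_edges_def)
    have TS: "T S r f \<subseteq> Pow S" using x(4) by (auto simp: T_def)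
    have "T S r f \<inter> N S r f F = {}" using TS cut unfolding N_def by blast
    moreover have finT: "finite (T S r f)" using S by (simp add: T_def)
    moreover have cardT: "card (T S r f) = k - 1" using x S by (simp add: T_def card_image)
    moreover have "N S r f F \<subseteq> vertex_pairs {1..n}"
      using cut_edges_subset[OF S(3)] S(3) by (auto simp: N_def vertex_pairs_def)
    ultimately have le: "measure_pmf.prob (gnp n p) {E. T S r f \<subseteq> E \<and> N S r f F \<inter> E = {}}
        \<le> p ^ (k - 1) * (1 - p) ^ card (N S r f F)"
      using gnp_le[OF p, of "T S r f" "N S r f F" n] by simp
    have finF: "finite F" "card F \<le> M" using x finite_subset[OF _ finite_vp] by (auto simp: \<F>_def)
    \<comment> \<open>\<open>F\<close> ranges over sets of pairs of \<open>{1..n}\<close> and may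
      overlap the tree or leave \<open>S\<close>, so this is only a lower bound. It suffices because
      \<open>1 - p \<le> 1\<close>.\<close>
    have "(k choose 2) - (k - 1) - M \<le> card (vertex_pairs S - T S r f - F)"
    proof -
      have "(k choose 2) = card (vertex_pairs S)" using S by (simp add: vertex_pairs_def n_subsets)
      then have "(k choose 2) - (k - 1) \<le> card (vertex_pairs S - T S r f)"
        using diff_card_le_card_Diff[OF finT, of "vertex_pairs S"] cardT by simp
      then show ?thesis
        using diff_card_le_card_Diff[OF finF(1), of "vertex_pairs S - T S r f"] finF by linarith
    qed
    moreover have "card (N S r f F) = card (cut_edges {1..n} S) + card (vertex_pairs S - T S r f - F)"
    proof -
      have "vertex_pairs S - T S r f - F \<subseteq> Pow S" by (auto simp: vertex_pairs_def)
      then show ?thesis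
        unfolding N_def using cut finite_vertex_pairs[OF S(1)] finite_subset[OF cut_edges_subset[OF S(3)] finite_vp]
        by (intro card_Un_disjoint) (simp, simp, blast)
    qed
    ultimately have "k * (n - k) + ((k choose 2) - (k - 1) - M) \<le> card (N S r f F)"
      using S by (simp add: card_cut_edges)
    then have "(1 - p) ^ card (N S r f F) \<le> (1 - p) ^ (k * (n - k) + ((k choose 2) - (k - 1) - M))"
      using p by (intro power_decreasing) auto
    then have "p ^ (k - 1) * (1 - p) ^ card (N S r f F) \<le> ?b" using p by (intro mult_left_mono) auto
    with le x(1) show "measure_pmf.prob (gnp n p)
        (case x of (x, xa) \<Rightarrow> (case x of (S, r, f) \<Rightarrow> \<lambda>F. {E. T S r f \<subseteq> E \<and> N S r f F \<inter> E = {}}) xa) \<le> ?b"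
      by simp
  next
    show "{E. tree_like n M k E} \<inter> set_pmf (gnp n p)
        \<subseteq> (\<Union>i\<in>I. case i of (x, xa) \<Rightarrow> (case x of (S, r, f) \<Rightarrow> \<lambda>F. {E. T S r f \<subseteq> E \<and> N S r f F \<inter> E = {}}) xa)"
    proof
      fix E assume "E \<in> {E. tree_like n M k E} \<inter> set_pmf (gnp n p)"
      then have E: "E \<subseteq> vertex_pairs {1..n}" "tree_like n M k E" using set_pmf_gnp by auto
      then obtain S r f where *: "S \<subseteq> {1..n}" "card S = k" "cut_edges {1..n} S \<inter> E = {}"
        "r \<in> S" "f \<in> S - {r} \<rightarrow>\<^sub>E S" "inj_on (\<lambda>v. {v, f v}) (S - {r})" "T S r f \<subseteq> E"
        "card (induced_edges E S - T S r f) \<le> M"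
        using E(2)[unfolded tree_like_def, folded T_def] by (elim exE conjE) (rule that)
      let ?F = "induced_edges E S - T S r f"
      have "?F \<in> \<F>" using * E by (auto simp: \<F>_def induced_edges_def)
      then have "((S, r, f), ?F) \<in> I" using * by (auto simp: I_def J_def \<S>_def)
      moreover have "N S r f ?F \<inter> E = {}"
        using * by (auto simp: N_def vertex_pairs_def induced_edges_def)
      ultimately show "E \<in> (\<Union>i\<in>I. case i of (x, xa) \<Rightarrow> (case x of (S, r, f) \<Rightarrow> \<lambda>F. {E. T S r f \<subseteq> E \<and> N S r f F \<inter> E = {}}) xa)"
        using *(7) by (intro UN_I[of "((S, r, f), ?F)"]) auto
    qed
  qed
  also have "\<dots> \<le> real ((n choose k) * (k * k ^ (k - 1)) * (Suc M * (n ^ 2) ^ M)) * ?b"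
    using cardI p by (intro mult_right_mono of_nat_mono) auto
  finally show ?thesis .
qed

section \<open>The expected number of short cycles\<close>

text \<open>Two positions with the same edge would be successors of each other, which needs length
  \<open>2\<close>. Hence a cycle of length \<open>l\<close> has \<open>l\<close> edges and is
  present with probability at most \<open>p ^ l\<close>.\<close>

lemma inj_on_cycle_edges:
  assumes "distinct xs" "3 \<le> length xs"
  shows "inj_on (\<lambda>i. {xs ! i, xs ! (Suc i mod length xs)}) {..<length xs}"
proof (rule inj_onI)
  let ?l = "length xs"
  fix i j assume ij: "i \<in> {..<?l}" "j \<in> {..<?l}"
    and eq: "{xs ! i, xs ! (Suc i mod ?l)} = {xs ! j, xs ! (Suc j mod ?l)}"
  have "0 < ?l" using assms(2) by linarith
  then have lt: "Suc i mod ?l < ?l" "Suc j mod ?l < ?l" by simp_all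
  from eq consider "xs ! i = xs ! j" | "xs ! i = xs ! (Suc j mod ?l)" "xs ! (Suc i mod ?l) = xs ! j"
    by (auto simp: doubleton_eq_iff)
  then show "i = j"
  proof cases
    case 1
    then show ?thesis using assms ij by (simp add: nth_eq_iff_index_eq)
  next
    case 2
    then have "i = Suc j mod ?l" "Suc i mod ?l = j" using assms ij lt by (auto simp: nth_eq_iff_index_eq)
    then show ?thesis using assms(2) ij by (auto simp: mod_Suc split: if_splits)
  qed
qed

text \<open>Markov's inequality for the number of short cycles; there are at most
  \<open>n ^ l\<close> vertex lists of length \<open>l\<close>. For \<open>p = c / n\<close> the
  bound does not depend on \<open>n\<close>.\<close>

lemma prob_many_short_cycles_le:
  assumes p: "0 \<le> p" "p \<le> 1"
  shows "real M * measure_pmf.prob (gnp n p) {E. M \<le> card (short_cycles E K)} \<le> (\<Sum>l\<le>K. (real n * p) ^ l)"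
proof -
  define ed where "ed xs = (\<lambda>i. {xs ! i, xs ! (Suc i mod length xs)}) ` {..<length xs}" for xs :: "nat list"
  define X where "X = {xs. set xs \<subseteq> {1..n} \<and> distinct xs \<and> 3 \<le> length xs \<and> length xs \<le> K}"
  have fin: "finite {xs. set xs \<subseteq> {1..n} \<and> length xs \<le> K}" by (rule finite_lists_length_le) simp
  have finX: "finite X" by (rule finite_subset[OF _ fin]) (auto simp: X_def)
  have "real M * measure_pmf.prob (gnp n p) {E. M \<le> card (short_cycles E K)} =
      (\<integral>E. real M * indicator {E. M \<le> card (short_cycles E K)} E \<partial>measure_pmf (gnp n p))" by simp
  also have "\<dots> \<le> (\<integral>E. (\<Sum>xs\<in>X. indicator {E. ed xs \<subseteq> E} E) \<partial>measure_pmf (gnp n p))"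
  proof (rule integral_mono_AE)
    show "AE E in measure_pmf (gnp n p). real M * indicator {E. M \<le> card (short_cycles E K)} E
        \<le> (\<Sum>xs\<in>X. indicator {E. ed xs \<subseteq> E} E)"
    proof (rule AE_pmfI)
      fix E assume "E \<in> set_pmf (gnp n p)"
      then have E: "E \<subseteq> vertex_pairs {1..n}" using set_pmf_gnp by auto
      have "(\<Sum>xs\<in>X. indicator {E. ed xs \<subseteq> E} E) = real (card {xs \<in> X. ed xs \<subseteq> E})"
        using finX by (simp add: indicator_def sum.If_cases Int_def)
      also have "{xs \<in> X. ed xs \<subseteq> E} = short_cycles E K"
        using short_cycles_subset[OF E] by (auto simp: short_cycles_def X_def ed_def)
      finally show "real M * indicator {E. M \<le> card (short_cycles E K)} E
          \<le> (\<Sum>xs\<in>X. indicator {E. ed xs \<subseteq> E} E)" by (auto simp: indicator_def)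
    qed
  qed (auto intro!: measure_pmf.integrable_const_bound[where B = "real M"]
         measure_pmf.integrable_const_bound[where B = 1] Bochner_Integration.integrable_sum)
  also have "\<dots> = (\<Sum>xs\<in>X. measure_pmf.prob (gnp n p) {E. ed xs \<subseteq> E})"
    by (subst Bochner_Integration.integral_sum) (auto intro!: measure_pmf.integrable_const_bound[where B = 1])
  also have "\<dots> \<le> (\<Sum>xs\<in>X. p ^ length xs)"
  proof (rule sum_mono)
    fix xs assume "xs \<in> X"
    then have "card (ed xs) = length xs"
      unfolding ed_def by (subst card_image[OF inj_on_cycle_edges]) (auto simp: X_def)
    moreover have "finite (ed xs)" by (simp add: ed_def)
    ultimately show "measure_pmf.prob (gnp n p) {E. ed xs \<subseteq> E} \<le> p ^ length xs"
      using gnp_le[OF p, of "ed xs" "{}" n] by simp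
  qed
  also have "\<dots> \<le> (\<Sum>xs\<in>{xs. set xs \<subseteq> {1..n} \<and> length xs \<le> K}. p ^ length xs)"
    using fin p by (intro sum_mono2) (auto simp: X_def)
  also have "{xs. set xs \<subseteq> {1..n} \<and> length xs \<le> K} = (\<Union>l\<in>{..K}. {xs. set xs \<subseteq> {1..n} \<and> length xs = l})" by auto
  also have "(\<Sum>xs\<in>\<dots>. p ^ length xs) = (\<Sum>l\<le>K. \<Sum>xs\<in>{xs. set xs \<subseteq> {1..n} \<and> length xs = l}. p ^ length xs)"
    by (rule sum.UNION_disjoint) (auto simp: finite_lists_length_eq)
  also have "\<dots> = (\<Sum>l\<le>K. (real n * p) ^ l)"
    by (rule sum.cong) (auto simp: card_lists_length_eq power_mult_distrib)
  finally show ?thesis .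
qed

section \<open>Asymptotics\<close>

lemma one_minus_power_le_exp:
  fixes x :: real
  assumes "x \<le> 1"
  shows "(1 - x) ^ m \<le> exp (- (x * real m))"
proof -
  have "(1 - x) ^ m \<le> exp (- x) ^ m" using assms exp_ge_add_one_self[of "- x"] by (intro power_mono) auto
  then show ?thesis by (simp add: exp_of_nat_mult[symmetric] mult.commute)
qed

lemma power_div_fact_le_exp:
  fixes x :: real
  assumes "0 \<le> x"
  shows "x ^ r / fact r \<le> exp x"
proof -
  have "(\<Sum>i\<in>{r}. x ^ i /\<^sub>R fact i) \<le> (\<Sum>i. x ^ i /\<^sub>R fact i)"
    using assms by (intro sum_le_suminf summable_exp_generic) auto
  then show ?thesis by (simp add: exp_def divide_inverse mult.commute)
qed

section \<open>Existence of a component of linear size\<close>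

text \<open>Bounding the binomial coefficient by \<open>n ^ r / fact r\<close> cancels the powers of
  \<open>n\<close>. The remaining factors satisfy \<open>c ^ r \<le> c ^ k\<close> and
  \<open>k ^ r / fact r \<le> exp k\<close>, uniformly in \<open>r\<close>.\<close>

lemma exploration_term_le:
  fixes c :: real
  assumes c: "1 \<le> c" "c \<le> real n" and k: "k \<le> n" "r \<le> k"
  shows "real (n choose r) * real k ^ r * ((c / n) ^ r * (1 - c / n) ^ (k * (n - k))) \<le>
    exp (k * (ln c + 1 - c + c * k / n))"
proof -
  have n: "0 < n" using c by (cases n) auto
  have "real (n choose r) * fact r \<le> real n ^ r"
    using binomial_fact_pow[of n r] by (metis of_nat_fact of_nat_le_iff of_nat_mult of_nat_power)
  then have bin: "real (n choose r) \<le> real n ^ r / fact r" by (simp add: pos_le_divide_eq)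
  have cr: "c ^ r \<le> exp (k * ln c)"
  proof -
    have "c ^ r \<le> c ^ k" using c k by (intro power_increasing) auto
    also have "c ^ k = exp (k * ln c)" using c by (simp add: exp_of_nat_mult)
    finally show ?thesis .
  qed
  have "(1 - c / n) ^ (k * (n - k)) \<le> exp (- (c / n * real (k * (n - k))))"
    using c n by (intro one_minus_power_le_exp) simp
  also have "- (c / n * real (k * (n - k))) = k * (- c + c * k / n)"
    using k n by (simp add: of_nat_diff field_simps)
  finally have pw: "(1 - c / n) ^ (k * (n - k)) \<le> exp (k * (- c + c * k / n))" .
  have "real (n choose r) * real k ^ r * ((c / n) ^ r * (1 - c / n) ^ (k * (n - k))) \<le>
      real n ^ r / fact r * real k ^ r * ((c / n) ^ r * (1 - c / n) ^ (k * (n - k)))"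
    using c n by (intro mult_right_mono bin) auto
  also have "\<dots> = c ^ r * (real k ^ r / fact r) * (1 - c / n) ^ (k * (n - k))"
    using n by (simp add: power_divide)
  also have "\<dots> \<le> exp (k * ln c) * exp k * exp (k * (- c + c * k / n))"
    using c n by (intro mult_mono cr power_div_fact_le_exp pw) auto
  also have "\<dots> = exp (k * (ln c + 1 - c + c * k / n))"
    by (simp add: exp_add[symmetric] algebra_simps)
  finally show ?thesis .
qed

lemma card_reached_Suc_le:
  assumes "j < n"
  shows "card (reached n E (Suc j)) \<le> card (reached n E j) + card {v \<in> {1..n}. (Suc j, v) \<in> (adj_rel E)\<^sup>*}"
proof -
  have "reached n E (Suc j) \<subseteq> reached n E j \<union> {v \<in> {1..n}. (Suc j, v) \<in> (adj_rel E)\<^sup>*}"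
    by (auto simp: reached_def le_Suc_eq)
  then have "card (reached n E (Suc j)) \<le> card (reached n E j \<union> {v \<in> {1..n}. (Suc j, v) \<in> (adj_rel E)\<^sup>*})"
    by (intro card_mono) (auto simp: reached_def)
  also have "\<dots> \<le> card (reached n E j) + card {v \<in> {1..n}. (Suc j, v) \<in> (adj_rel E)\<^sup>*}"
    by (rule card_Un_le)
  finally show ?thesis .
qed

text \<open>Each step of the exploration adds at most one component, that is fewer than
  \<open>a * n\<close> vertices. The first size to attain \<open>a * n\<close> therefore stays below
  \<open>2 * a * n\<close>.\<close>

lemma reached_jump:
  fixes a :: real
  assumes a: "0 < a" "a \<le> 1" and n: "0 < n"
    and small: "\<forall>D\<in>components {1..n} E. real (card D) < a * n"
  obtains j where "j \<le> n" "a * n \<le> card (reached n E j)" "card (reached n E j) < 2 * a * n"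
proof -
  define j where "j = (LEAST j. a * n \<le> card (reached n E j))"
  have "reached n E n = {1..n}" by (auto simp: reached_def)
  then have n': "a * n \<le> card (reached n E n)" using a by (simp add: mult_left_le_one_le)
  then have j: "a * n \<le> card (reached n E j)" unfolding j_def by (rule LeastI)
  have jn: "j \<le> n" unfolding j_def using n' by (rule Least_le)
  have "j \<noteq> 0"
  proof
    assume "j = 0"
    then have "reached n E j = {}" by (simp add: reached_def)
    with j a n show False by (simp add: mult_le_0_iff)
  qed
  then obtain i where i: "j = Suc i" using not0_implies_Suc by blast
  then have "\<not> a * n \<le> card (reached n E i)" unfolding j_def by (intro not_less_Least) simp
  moreover have "{v \<in> {1..n}. (Suc i, v) \<in> (adj_rel E)\<^sup>*} \<in> components {1..n} E"
    using i jn by (auto simp: components_def)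
  ultimately have "card (reached n E j) < 2 * a * n"
    using card_reached_Suc_le[of i n E] small i jn by fastforce
  with j jn that show ?thesis by blast
qed

lemma prob_all_components_small_le:
  fixes c a :: real
  assumes c: "1 < c" "c \<le> real n" and a: "0 < a" "a \<le> 1" "4 * c * a \<le> c - 1 - ln c"
  shows "measure_pmf.prob (gnp n (c / n)) {E. \<forall>D\<in>components {1..n} E. real (card D) < a * n}
    \<le> (real n + 1)\<^sup>2 * exp (- ((c - 1 - ln c) / 2 * a * n))"
proof -
  \<comment> \<open>The exponent per vertex is \<open>- 2 * \<eta> + c * k / n\<close>. For
    \<open>k < 2 * a * n\<close> the choice of \<open>a\<close> keeps the last term below
    \<open>\<eta>\<close>, which leaves a decay rate of at least \<open>\<eta>\<close>.\<close>
  define \<eta> where "\<eta> = (c - 1 - ln c) / 2"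
  have n: "0 < n" using c by (cases n) auto
  have p: "0 \<le> c / n" "c / n \<le> 1" using c n by auto
  have "0 < 4 * c * a" using a c by simp
  then have "0 < c - 1 - ln c" using a(3) by linarith
  then have \<eta>: "0 < \<eta>" "2 * c * a \<le> \<eta>" using a(3) by (simp_all add: \<eta>_def)
  define I where "I = {(j, k). j \<le> n \<and> k \<le> n \<and> j \<le> k \<and> a * n \<le> real k \<and> real k < 2 * a * n}"
  have I: "I \<subseteq> {..n} \<times> {..n}" by (auto simp: I_def)
  have "card I \<le> (n + 1)\<^sup>2" using card_mono[OF _ I] by (simp add: power2_eq_square)
  then have cardI: "real (card I) \<le> (real n + 1)\<^sup>2"
    by (metis of_nat_1 of_nat_add of_nat_le_iff of_nat_power)
  have "measure_pmf.prob (gnp n (c / n)) {E. \<forall>D\<in>components {1..n} E. real (card D) < a * n}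
      \<le> real (card I) * exp (- (\<eta> * a * n))"
  proof (rule union_bound[where A = "\<lambda>(j, k). {E. card (reached n E j) = k}"])
    show "finite I" using I by (rule finite_subset) simp
    fix x assume "x \<in> I"
    then obtain j k where x: "x = (j, k)" "j \<le> n" "k \<le> n" "j \<le> k" "a * n \<le> real k" "real k < 2 * a * n"
      by (auto simp: I_def)
    have "c * k / n \<le> \<eta>"
    proof -
      have "c * k \<le> c * (2 * a * n)" using x c by (intro mult_left_mono) auto
      then have "c * k / n \<le> 2 * c * a" using n by (simp add: field_simps)
      with \<eta> show ?thesis by simp
    qed
    moreover have "ln c + 1 - c = - 2 * \<eta>" by (simp add: \<eta>_def)
    ultimately have "ln c + 1 - c + c * k / n \<le> - \<eta>" by linarith
    then have "k * (ln c + 1 - c + c * k / n) \<le> k * (- \<eta>)" by (rule mult_left_mono) simp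
    also have "\<dots> \<le> - (\<eta> * a * n)" using mult_left_mono[OF x(5), of \<eta>] \<eta> by (simp add: mult_ac)
    finally have "exp (k * (ln c + 1 - c + c * k / n)) \<le> exp (- (\<eta> * a * n))" by simp
    moreover have "measure_pmf.prob (gnp n (c / n)) {E. card (reached n E j) = k} \<le> exp (k * (ln c + 1 - c + c * k / n))"
      using prob_card_reached_le[OF p x(2,4)] exploration_term_le[of c n k "k - j"] c x(3) by auto
    ultimately have "measure_pmf.prob (gnp n (c / n)) {E. card (reached n E j) = k} \<le> exp (- (\<eta> * a * n))"
      by linarith
    then show "measure_pmf.prob (gnp n (c / n)) (case x of (j, k) \<Rightarrow> {E. card (reached n E j) = k}) \<le> exp (- (\<eta> * a * n))"
      by (simp add: x(1))
  next
    show "{E. \<forall>D\<in>components {1..n} E. real (card D) < a * n} \<inter> set_pmf (gnp n (c / n))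
        \<subseteq> (\<Union>i\<in>I. case i of (j, k) \<Rightarrow> {E. card (reached n E j) = k})"
    proof
      fix E assume "E \<in> {E. \<forall>D\<in>components {1..n} E. real (card D) < a * n} \<inter> set_pmf (gnp n (c / n))"
      then obtain j where j: "j \<le> n" "a * n \<le> card (reached n E j)" "card (reached n E j) < 2 * a * n"
        using reached_jump[OF a(1,2) n] by blast
      have "{1..j} \<subseteq> reached n E j" using j(1) by (auto simp: reached_def)
      from card_mono[OF _ this] have "j \<le> card (reached n E j)"
        using finite_subset[OF reached_subset] by simp
      moreover have "card (reached n E j) \<le> n"
        using card_mono[OF _ reached_subset[of n E j]] by simp
      ultimately have "(j, card (reached n E j)) \<in> I" using j by (simp add: I_def)
      then show "E \<in> (\<Union>i\<in>I. case i of (j, k) \<Rightarrow> {E. card (reached n E j) = k})" by fastforce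
    qed
  qed
  also have "\<dots> \<le> (real n + 1)\<^sup>2 * exp (- (\<eta> * a * n))" using cardI by (rule mult_right_mono) simp
  finally show ?thesis by (simp add: \<eta>_def)
qed

section \<open>Exponential decay of the expected number of tree-like components\<close>

text \<open>
  The exponential rate of the expected number of tree components on \<open>x n\<close> vertices, maximised
  over \<open>c\<close>.
\<close>

definition tree_rate :: "real \<Rightarrow> real" where
  "tree_rate x = - x * ln (1 - x / 2) - x - (1 - x) * ln (1 - x)"

text \<open>With \<open>y = (1 - x) / (1 - x / 2)\<close> the derivative is
  \<open>ln y - (y - 1)\<close>, which is negative unless \<open>y = 1\<close>, that is
  \<open>x = 0\<close>.\<close>

lemma tree_rate_deriv:
  assumes "0 \<le> x" "x < 1"
  shows "\<exists>D. (tree_rate has_real_derivative D) (at x) \<and> D \<le> 0 \<and> (0 < x \<longrightarrow> D < 0)"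
proof (intro exI conjI)
  let ?D = "ln (1 - x) - ln (1 - x / 2) + x / (2 - x)"
  show "(tree_rate has_real_derivative ?D) (at x)"
  proof -
    have "(tree_rate has_real_derivative
        - (ln (1 - x / 2) + x * (- (1 / 2) / (1 - x / 2))) - 1 - (- ln (1 - x) + (1 - x) * (- 1 / (1 - x)))) (at x)"
      unfolding tree_rate_def [abs_def] using assms by (auto intro!: derivative_eq_intros)
    moreover have "x * (- (1 / 2) / (1 - x / 2)) = - (x / (2 - x))" "(1 - x) * (- 1 / (1 - x)) = - 1"
      using assms by (simp_all add: field_simps)
    ultimately show ?thesis by (simp add: algebra_simps)
  qed
  let ?y = "(1 - x) / (1 - x / 2)"
  have y: "0 < ?y" "?y - 1 = - (x / (2 - x))" using assms by (auto simp: field_simps)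
  have ln: "ln (1 - x) - ln (1 - x / 2) = ln ?y" using assms by (simp add: ln_div)
  show "?D \<le> 0" using ln_le_minus_one[OF y(1)] y(2) ln by simp
  show "0 < x \<longrightarrow> ?D < 0"
  proof
    assume "0 < x"
    then have "?y - 1 \<noteq> 0" unfolding y(2) using assms by auto
    then have "?y \<noteq> 1" by simp
    then show "?D < 0" using ln_le_minus_one[OF y(1)] ln_eq_minus_one[OF y(1)] y(2) ln by linarith
  qed
qed

lemma tree_rate_bound:
  assumes a: "0 < a" "a \<le> 1"
  obtains \<gamma> where "0 < \<gamma>" "\<And>x. a \<le> x \<Longrightarrow> x \<le> 1 \<Longrightarrow> tree_rate x \<le> - \<gamma>"
proof -
  define b where "b = a / 2"
  have b: "0 < b" "b < a" "b < 1" using a by (auto simp: b_def)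
  have mono: "tree_rate y \<le> tree_rate x" if "0 \<le> x" "x \<le> y" "y < 1" for x y
  proof (rule DERIV_nonpos_imp_nonincreasing[OF that(2)])
    fix z assume "x \<le> z" "z \<le> y"
    then show "\<exists>D. (tree_rate has_real_derivative D) (at z) \<and> D \<le> 0"
      using tree_rate_deriv[of z] that by auto
  qed
  \<comment> \<open>For \<open>a = 1\<close> only the endpoint remains, and \<open>3 / 4\<close> is
    an arbitrary point between \<open>b = 1 / 2\<close> and \<open>1\<close>.\<close>
  define a' where "a' = (if a = 1 then 3 / 4 else a)"
  have a': "b < a'" "a' < 1" using a b by (auto simp: a'_def b_def)
  have "tree_rate a' < tree_rate b"
  proof (rule DERIV_neg_imp_decreasing[OF a'(1)])
    fix z assume "b \<le> z" "z \<le> a'"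
    then show "\<exists>D. (tree_rate has_real_derivative D) (at z) \<and> D < 0"
      using tree_rate_deriv[of z] a' b by auto
  qed
  moreover have "tree_rate b \<le> 0" using mono[of 0 b] b by (simp add: tree_rate_def)
  ultimately have neg: "tree_rate a' < 0" by simp
  have ln2: "ln 2 < (1 :: real)" using ln_2_less_1 .
  show ?thesis
  proof
    show "0 < min (- tree_rate a') (1 - ln 2)" using neg ln2 by simp
    fix x assume x: "a \<le> x" "x \<le> 1"
    show "tree_rate x \<le> - min (- tree_rate a') (1 - ln 2)"
    proof (cases "x = 1")
      case True
      \<comment> \<open>The last term of the rate is \<open>0 * ln 0 = 0\<close> here.\<close>
      then have "tree_rate x = ln 2 - 1" by (simp add: tree_rate_def ln_div)
      then show ?thesis by simp
    next
      case False
      then have "tree_rate x \<le> tree_rate a'" using x a' b by (intro mono) (auto simp: a'_def)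
      then show ?thesis by simp
    qed
  qed
qed

text \<open>A single term of the binomial expansion of \<open>(x + (1 - x)) ^ n\<close> is at most
  \<open>1\<close>, which bounds the binomial coefficient. The inequality
  \<open>ln t \<le> t - 1\<close> at \<open>t = c * (1 - x / 2)\<close> then eliminates
  \<open>c\<close>.\<close>

lemma tree_count_le:
  fixes c :: real
  assumes c: "1 < c" and k: "1 \<le> k" "k \<le> n"
  shows "real (n choose k) * (k * c / n) ^ k * exp (- (c * k * (1 - k / (2 * real n)))) \<le> exp (n * tree_rate (k / n))"
proof -
  define x where "x = real k / n"
  have n: "0 < n" using k by simp
  have x: "0 < x" "x \<le> 1" and kx: "real k = n * x" using k n by (auto simp: x_def)
  have "real (n choose k) * x ^ k * (1 - x) ^ (n - k) \<le> (\<Sum>i\<le>n. real (n choose i) * x ^ i * (1 - x) ^ (n - i))"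
    using x k by (intro member_le_sum) auto
  also have "\<dots> = 1" using binomial_ring[of x "1 - x" n] by simp
  finally have bin: "real (n choose k) * x ^ k * (1 - x) ^ (n - k) \<le> 1" .
  have pw: "(1 - x) ^ (n - k) = exp ((n - k) * ln (1 - x))"
  proof (cases "x = 1")
    case True
    then have "k = n" using n by (simp add: x_def)
    then show ?thesis by simp
  next
    case False
    then show ?thesis using x by (simp add: exp_of_nat_mult)
  qed
  have bin': "real (n choose k) * x ^ k \<le> exp (- ((n - k) * ln (1 - x)))"
    using bin unfolding pw by (simp add: exp_minus field_simps)
  have "0 < c * (1 - x / 2)" using c x by simp
  from ln_le_minus_one[OF this] have ln: "ln c + ln (1 - x / 2) \<le> c * (1 - x / 2) - 1"
    using c x by (simp add: ln_mult)
  have "real (n choose k) * (k * c / n) ^ k * exp (- (c * k * (1 - k / (2 * real n)))) =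
      real (n choose k) * x ^ k * (c ^ k * exp (- (c * k * (1 - x / 2))))"
    by (simp add: x_def power_mult_distrib power_divide)
  also have "\<dots> \<le> exp (- ((n - k) * ln (1 - x))) * (c ^ k * exp (- (c * k * (1 - x / 2))))"
    using c by (intro mult_right_mono bin') auto
  also have "\<dots> = exp (n * (x * (ln c - c * (1 - x / 2)) - (1 - x) * ln (1 - x)))"
  proof -
    have ck: "c ^ k = exp (k * ln c)" using c by (simp add: exp_of_nat_mult)
    have nk: "real (n - k) = n * (1 - x)" using k kx by (simp add: of_nat_diff algebra_simps)
    show ?thesis unfolding ck nk exp_add[symmetric] kx by (simp add: algebra_simps)
  qed
  also have "\<dots> \<le> exp (n * tree_rate x)"
  proof -
    have "x * (ln c - c * (1 - x / 2)) \<le> x * (- ln (1 - x / 2) - 1)"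
      using ln x by (intro mult_left_mono) auto
    then have "x * (ln c - c * (1 - x / 2)) - (1 - x) * ln (1 - x) \<le> tree_rate x"
      by (simp add: tree_rate_def algebra_simps)
    then have "n * (x * (ln c - c * (1 - x / 2)) - (1 - x) * ln (1 - x)) \<le> n * tree_rate x"
      by (rule mult_left_mono) simp
    then show ?thesis by simp
  qed
  finally show ?thesis by (simp add: x_def)
qed

text \<open>Up to terms of order \<open>k + M\<close>, the number of absent pairs is
  \<open>k * n * (1 - k / (2 * n))\<close>. Multiplied by \<open>c / n\<close>, these terms cost at
  most the constant \<open>c * (M + 2)\<close>. The power of \<open>n\<close> comes from the extra
  edges and from replacing the exponent \<open>k - 1\<close> by \<open>k\<close>.\<close>

lemma tree_like_term_le:
  fixes c :: real
  assumes c: "1 < c" "c \<le> real n" and k: "1 \<le> k" "k \<le> n"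
  shows "real ((n choose k) * (k * k ^ (k - 1)) * (Suc M * (n ^ 2) ^ M)) *
      ((c / n) ^ (k - 1) * (1 - c / n) ^ (k * (n - k) + ((k choose 2) - (k - 1) - M))) \<le>
    Suc M * exp (c * (real M + 2)) * real n ^ (2 * M + 1) * exp (n * tree_rate (k / n))"
proof -
  let ?N = "k * (n - k) + ((k choose 2) - (k - 1) - M)"
  have n: "0 < n" using k by simp
  have "real (k choose 2) = real k * (real k - 1) / 2"
    using k by (simp add: choose_two real_of_nat_div even_mult_iff of_nat_diff)
  \<comment> \<open>Truncated subtraction in \<open>?N\<close> can only make the right side
    larger.\<close>
  then have "real k * (real n - real k) + real k * (real k - 1) / 2 - (real k - 1) - M \<le> real ?N"
    using k by (simp add: of_nat_diff)
  then have "c / n * (real k * (real n - real k) + real k * (real k - 1) / 2 - (real k - 1) - M) \<le> c / n * real ?N"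
    using c by (intro mult_left_mono) auto
  moreover have "c / n * (real k * (real n - real k) + real k * (real k - 1) / 2 - (real k - 1) - M)
      = c * k * (1 - k / (2 * real n)) - c * (k / n * (3 / 2) - 1 / n + M / n)"
    using n by (simp add: field_simps)
  moreover have "c * (k / n * (3 / 2) - 1 / n + M / n) \<le> c * (real M + 2)"
  proof (rule mult_left_mono)
    have *: "u * (3 / 2) - v + w \<le> m + 2" if "u \<le> 1" "0 \<le> v" "w \<le> m" for u v w m :: real
      using that by linarith
    have "real k / n \<le> 1" "0 \<le> 1 / real n" using k n by auto
    moreover have "real M / n \<le> real M / 1" using n by (intro divide_left_mono) auto
    ultimately show "real k / n * (3 / 2) - 1 / n + M / n \<le> real M + 2" by (intro *) simp_all
  qed (use c in simp)
  ultimately have ex: "c * k * (1 - k / (2 * real n)) - c * (real M + 2) \<le> c / n * real ?N" by linarith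
  have "(1 - c / n) ^ ?N \<le> exp (- (c / n * real ?N))"
    using c n by (intro one_minus_power_le_exp) simp
  also have "\<dots> \<le> exp (c * (real M + 2) + - (c * k * (1 - k / (2 * real n))))" using ex by simp
  also have "\<dots> = exp (c * (real M + 2)) * exp (- (c * k * (1 - k / (2 * real n))))" by (rule exp_add)
  finally have pw: "(1 - c / n) ^ ?N \<le> exp (c * (real M + 2)) * exp (- (c * k * (1 - k / (2 * real n))))" .
  have cn: "(c / n) ^ (k - 1) \<le> (c / n) ^ k * n"
  proof -
    have "(c / n) ^ k * n = (c / n) ^ (k - 1) * c" using k n by (cases k) auto
    moreover have "(c / n) ^ (k - 1) * 1 \<le> (c / n) ^ (k - 1) * c" using c by (intro mult_left_mono) auto
    ultimately show ?thesis by linarith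
  qed
  have n2: "real n ^ (2 * M + 1) = real n * (real n ^ 2) ^ M" by (simp add: power_mult)
  have kk: "k * k ^ (k - 1) = k ^ k" using k by (cases k) auto
  have "real ((n choose k) * (k * k ^ (k - 1)) * (Suc M * (n ^ 2) ^ M)) * ((c / n) ^ (k - 1) * (1 - c / n) ^ ?N)
      \<le> real ((n choose k) * (k * k ^ (k - 1)) * (Suc M * (n ^ 2) ^ M)) *
        ((c / n) ^ k * n * (exp (c * (real M + 2)) * exp (- (c * k * (1 - k / (2 * real n))))))"
    using c n by (intro mult_left_mono mult_mono pw cn) auto
  also have "\<dots> = Suc M * exp (c * (real M + 2)) * real n ^ (2 * M + 1) *
      (real (n choose k) * (k * c / n) ^ k * exp (- (c * k * (1 - k / (2 * real n)))))"
    unfolding kk n2 by (simp add: power_mult_distrib power_divide mult_ac del: of_nat_Suc mult_Suc)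
  also have "\<dots> \<le> Suc M * exp (c * (real M + 2)) * real n ^ (2 * M + 1) * exp (n * tree_rate (k / n))"
    using tree_count_le[OF c(1) k] by (rule mult_left_mono) simp
  finally show ?thesis .
qed

lemma prob_tree_like_ex_le:
  fixes c a :: real
  assumes c: "1 < c" "c \<le> real n" and a: "0 < a"
    and \<gamma>: "\<And>x. a \<le> x \<Longrightarrow> x \<le> 1 \<Longrightarrow> tree_rate x \<le> - \<gamma>"
  shows "measure_pmf.prob (gnp n (c / n)) {E. \<exists>k\<le>n. a * n \<le> real k \<and> tree_like n M k E}
    \<le> Suc M * exp (c * (real M + 2)) * (real n ^ (2 * M + 2) * exp (- (\<gamma> * n)))"
proof -
  have n: "0 < n" using c by (cases n) auto
  have p: "0 \<le> c / n" "c / n \<le> 1" using c n by auto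
  define I where "I = {k. k \<le> n \<and> a * n \<le> real k}"
  let ?b = "Suc M * exp (c * (real M + 2)) * real n ^ (2 * M + 1) * exp (- (\<gamma> * n))"
  have I: "I \<subseteq> {1..n}"
  proof
    fix k assume "k \<in> I"
    then have "k \<le> n" "a * n \<le> real k" by (auto simp: I_def)
    moreover have "0 < a * n" using a n by simp
    ultimately show "k \<in> {1..n}" by (cases k) auto
  qed
  have "measure_pmf.prob (gnp n (c / n)) {E. \<exists>k\<le>n. a * n \<le> real k \<and> tree_like n M k E} \<le> real (card I) * ?b"
  proof (rule union_bound[where A = "\<lambda>k. {E. tree_like n M k E}"])
    show "finite I" using I by (rule finite_subset) simp
    fix k assume kI: "k \<in> I"
    then have k: "1 \<le> k" "k \<le> n" "a * n \<le> real k" using I by (auto simp: I_def)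
    have "tree_rate (k / n) \<le> - \<gamma>" using k n by (intro \<gamma>) (auto simp: field_simps)
    then have "n * tree_rate (k / n) \<le> n * - \<gamma>" by (rule mult_left_mono) simp
    then have "exp (n * tree_rate (k / n)) \<le> exp (- (\<gamma> * n))" by (simp add: mult.commute)
    then have "Suc M * exp (c * (real M + 2)) * real n ^ (2 * M + 1) * exp (n * tree_rate (k / n)) \<le> ?b"
      by (intro mult_left_mono) auto
    with tree_like_term_le[OF c k(1,2), of M] prob_tree_like_le[OF p, of n M k] n
    show "measure_pmf.prob (gnp n (c / n)) {E. tree_like n M k E} \<le> ?b"
      by linarith
  qed (auto simp: I_def)
  \<comment> \<open>There are at most \<open>n\<close> sizes \<open>k\<close>, which raises the
    exponent of \<open>n\<close> to \<open>2 * M + 2\<close>.\<close>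
  also have "\<dots> \<le> real n * ?b" using card_mono[OF _ I] by (intro mult_right_mono) auto
  also have "real n * ?b = Suc M * exp (c * (real M + 2)) * (real n ^ (2 * M + 2) * exp (- (\<gamma> * n)))"
  proof -
    have "real n ^ (2 * M + 2) = real n * real n ^ (2 * M + 1)" by simp
    then show ?thesis by (simp only: mult_ac)
  qed
  finally show ?thesis .
qed

lemma power_times_exp_tendsto_0:
  fixes \<gamma> :: real
  assumes "0 < \<gamma>"
  shows "(\<lambda>n. real n ^ m * exp (- (\<gamma> * n))) \<longlonglongrightarrow> 0"
proof -
  have "filterlim (\<lambda>n. \<gamma> * real n) at_top sequentially"
    using assms by (intro filterlim_tendsto_pos_mult_at_top[OF tendsto_const] filterlim_real_sequentially)
  from tendsto_mult_right_zero[OF filterlim_compose[OF tendsto_power_div_exp_0 this], of "inverse (\<gamma> ^ m)" m]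
  show ?thesis using assms by (simp add: power_mult_distrib exp_minus field_simps)
qed

section \<open>The largest component\<close>

text \<open>The deterministic part, valid for every component. Parents towards \<open>u\<close> give
  a spanning tree of \<open>C\<close>; as \<open>C\<close> is not tree-like, more than
  \<open>M\<close> of its edges lie outside that tree, hence more than there are short
  cycles.\<close>

lemma largest_component_not_hyperbolic:
  fixes E :: "nat set set"
  assumes E: "E \<subseteq> vertex_pairs {1..n}" and C: "C \<in> components {1..n} E"
    and not_tree: "\<not> tree_like n M (card C) E" and short: "card (short_cycles E K) \<le> M"
    and K: "12 \<le> K" "\<And>L. K < L \<Longrightarrow> \<delta> < real (L div 6)"
  shows "\<not> hyperbolic C (induced_edges E C) \<delta>"
proof -
  obtain u where u: "u \<in> {1..n}" and Cdef: "C = {v \<in> {1..n}. (u, v) \<in> (adj_rel E)\<^sup>*}"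
    using C by (auto simp: components_def)
  have sub: "C \<subseteq> {1..n}" "u \<in> C" using u by (auto simp: Cdef)
  have finC: "finite C" using sub(1) by (rule finite_subset) simp
  have closed: "x \<in> C" if "{x, y} \<in> E" "y \<in> C" for x y
  proof -
    have "(y, x) \<in> adj_rel E" using that(1) by (simp add: adj_rel_def insert_commute)
    then show ?thesis
      using that edge_mem[OF E that(1)] unfolding Cdef by (blast intro: rtrancl.rtrancl_into_rtrancl)
  qed
  have roots: "\<exists>r\<in>{u}. (r, v) \<in> (adj_rel E)\<^sup>*" if "v \<in> C" for v using that by (simp add: Cdef)
  obtain f where f: "f \<in> C - {u} \<rightarrow>\<^sub>E C" "\<And>v. v \<in> C - {u} \<Longrightarrow> {v, f v} \<in> E"
      "inj_on (\<lambda>v. {v, f v}) (C - {u})"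
    and conn: "\<And>v. v \<in> C \<Longrightarrow> \<exists>r\<in>{u}. (r, v) \<in> (adj_rel ((\<lambda>v. {v, f v}) ` (C - {u})))\<^sup>*"
    by (rule spanning_forest[of C "{u}" E]) (erule roots, erule (1) closed, blast)
  define T where "T = (\<lambda>v. {v, f v}) ` (C - {u})"
  have TE: "T \<subseteq> E" using f by (auto simp: T_def)
  have T: "T \<subseteq> induced_edges E C" using f by (auto simp: T_def induced_edges_def)
  have ind: "induced_edges E C \<subseteq> vertex_pairs C" using E by (auto simp: induced_edges_def vertex_pairs_def)
  have "cut_edges {1..n} C \<inter> E = {}"
    by (auto simp: cut_edges_def) (metis insert_commute closed)
  with not_tree sub f TE have "\<not> card (induced_edges E C - T) \<le> M"
    unfolding tree_like_def T_def by blast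
  moreover have "card (short_cycles (induced_edges E C) K) \<le> card (short_cycles E K)"
    by (intro card_mono finite_short_cycles[OF _ E] short_cycles_mono) (auto simp: induced_edges_def)
  ultimately have few: "card (short_cycles (induced_edges E C) K) < card (induced_edges E C - T)"
    using short by linarith
  have conn': "(u, v) \<in> (adj_rel T)\<^sup>*" if "v \<in> C" for v using conn[OF that] by (simp add: T_def)
  show ?thesis by (rule few_short_cycles_not_hyperbolic[OF finC ind T conn' few K])
qed

theorem theorem2p2:
  fixes c \<delta> :: real and H :: "nat \<Rightarrow> nat set set \<Rightarrow> nat set"
  assumes "c > 1"
    and "\<And>n E. c \<le> real n \<Longrightarrow> E \<subseteq> vertex_pairs {1..n} \<Longrightarrow> largest_component {1..n} E (H n E)"
    and "\<delta> \<ge> 0"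
  shows "(\<lambda>n. measure_pmf.prob (gnp n (c / real n))
            {E. \<not> hyperbolic (H n E) (induced_edges E (H n E)) \<delta>}) \<longlonglongrightarrow> 1"
proof -
  note c = assms(1)
  \<comment> \<open>\<open>L > K\<close> forces
    \<open>L div 6 \<ge> nat \<lceil>\<delta>\<rceil> + 2\<close>, which exceeds
    \<open>\<delta>\<close>.\<close>
  define K where "K = 6 * (nat \<lceil>\<delta>\<rceil> + 2)"
  have K: "12 \<le> K" "\<And>L. K < L \<Longrightarrow> \<delta> < real (L div 6)"
  proof -
    show "12 \<le> K" by (simp add: K_def)
    fix L assume "K < L"
    then have "nat \<lceil>\<delta>\<rceil> < L div 6" by (simp add: K_def)
    then show "\<delta> < real (L div 6)" by linarith
  qed
  have pos: "0 < c - 1 - ln c"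
    using ln_le_minus_one[of c] ln_eq_minus_one[of c] c by linarith
  define a where "a = min 1 ((c - 1 - ln c) / (4 * c))"
  have a: "0 < a" "a \<le> 1" "4 * c * a \<le> c - 1 - ln c"
  proof -
    show "0 < a" "a \<le> 1" using pos c by (auto simp: a_def)
    have "4 * c * a \<le> 4 * c * ((c - 1 - ln c) / (4 * c))"
      using c by (intro mult_left_mono) (auto simp: a_def)
    then show "4 * c * a \<le> c - 1 - ln c" using c by simp
  qed
  obtain \<gamma> where \<gamma>: "0 < \<gamma>" "\<And>x. a \<le> x \<Longrightarrow> x \<le> 1 \<Longrightarrow> tree_rate x \<le> - \<gamma>"
    using tree_rate_bound[OF a(1,2)] by blast
  define hyp where "hyp n = measure_pmf.prob (gnp n (c / n)) {E. hyperbolic (H n E) (induced_edges E (H n E)) \<delta>}" for n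
  define Q where "Q = (\<Sum>l\<le>K. c ^ l)"
  define f where "f M n = (real n + 1)\<^sup>2 * exp (- ((c - 1 - ln c) / 2 * a * n)) +
      Suc M * exp (c * (real M + 2)) * (real n ^ (2 * M + 2) * exp (- (\<gamma> * n)))" for M n :: nat
  have f0: "f M \<longlonglongrightarrow> 0" for M
  proof -
    have "0 < (c - 1 - ln c) / 2 * a" using pos a by simp
    note lim = power_times_exp_tendsto_0[OF this]
    have "(\<lambda>n. real n ^ 2 * exp (- ((c - 1 - ln c) / 2 * a * n)) + 2 * (real n ^ 1 * exp (- ((c - 1 - ln c) / 2 * a * n)))
        + real n ^ 0 * exp (- ((c - 1 - ln c) / 2 * a * n))
        + Suc M * exp (c * (real M + 2)) * (real n ^ (2 * M + 2) * exp (- (\<gamma> * n)))) \<longlonglongrightarrow> 0 + 2 * 0 + 0 + Suc M * exp (c * (real M + 2)) * 0"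
      by (intro tendsto_intros lim power_times_exp_tendsto_0[OF \<gamma>(1)])
    then show ?thesis unfolding f_def [abs_def] by (simp add: power2_eq_square algebra_simps)
  qed
  have bound: "hyp n \<le> f M n + Q / Suc M" if n: "c \<le> real n" for n M
  proof -
    let ?P = "measure_pmf.prob (gnp n (c / n))"
    let ?A = "{E. \<forall>D\<in>components {1..n} E. real (card D) < a * n}"
    let ?B = "{E. \<exists>k\<le>n. a * n \<le> real k \<and> tree_like n M k E}"
    let ?S = "{E. Suc M \<le> card (short_cycles E K)}"
    have n0: "0 < n" using n c by (cases n) auto
    have p: "0 \<le> c / n" "c / n \<le> 1" using c n n0 by auto
    \<comment> \<open>A hyperbolic largest component leaves three bad events: all components are
      small, some linear-sized set is tree-like, or there are more than \<open>M\<close> short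
      cycles.\<close>
    have "{E. hyperbolic (H n E) (induced_edges E (H n E)) \<delta>} \<inter> set_pmf (gnp n (c / n)) \<subseteq> ?A \<union> ?B \<union> ?S"
    proof (rule subsetI, rule ccontr)
      fix E assume *: "E \<in> {E. hyperbolic (H n E) (induced_edges E (H n E)) \<delta>} \<inter> set_pmf (gnp n (c / n))"
        and E': "E \<notin> ?A \<union> ?B \<union> ?S"
      have E: "E \<subseteq> vertex_pairs {1..n}" using * set_pmf_gnp by auto
      from assms(2)[OF n E] have C: "H n E \<in> components {1..n} E"
        and max: "\<And>D. D \<in> components {1..n} E \<Longrightarrow> card D \<le> card (H n E)"
        by (auto simp: largest_component_def)
      obtain D where "D \<in> components {1..n} E" "a * n \<le> card D" using E' by force
      with max[of D] have "a * n \<le> card (H n E)" by linarith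
      moreover have "card (H n E) \<le> n"
      proof -
        have "H n E \<subseteq> {1..n}" using C by (auto simp: components_def)
        from card_mono[OF _ this] show ?thesis by simp
      qed
      ultimately have "\<not> tree_like n M (card (H n E)) E" using E' by blast
      moreover have "card (short_cycles E K) \<le> M" using E' by auto
      ultimately have "\<not> hyperbolic (H n E) (induced_edges E (H n E)) \<delta>"
        using largest_component_not_hyperbolic[OF E C _ _ K] by blast
      with * show False by blast
    qed
    then have "hyp n \<le> ?P (?A \<union> ?B \<union> ?S)"
      unfolding hyp_def by (subst measure_Int_set_pmf[symmetric]) (intro measure_pmf.finite_measure_mono, auto)
    also have "\<dots> \<le> ?P ?A + ?P ?B + ?P ?S"
      using measure_Un_le[of "?A \<union> ?B" "gnp n (c / n)" ?S] measure_Un_le[of ?A "gnp n (c / n)" ?B]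
      by simp
    also have "?P ?S \<le> Q / Suc M"
      using prob_many_short_cycles_le[OF p, of "Suc M" n K] n0 by (simp add: Q_def field_simps)
    also have "?P ?A + ?P ?B \<le> f M n"
      unfolding f_def using prob_all_components_small_le[OF c n a] prob_tree_like_ex_le[OF c n a(1) \<gamma>(2), of M]
      by (rule add_mono)
    finally show ?thesis by simp
  qed
  have "hyp \<longlonglongrightarrow> 0"
  proof (rule LIMSEQ_I)
    fix \<epsilon> :: real assume \<epsilon>: "0 < \<epsilon>"
    \<comment> \<open>The order of choices matters: \<open>M\<close> is first taken so large that
      many short cycles are unlikely for all large \<open>n\<close>; with \<open>M\<close> fixed,
      \<open>f M n\<close> then tends to \<open>0\<close>.\<close>
    obtain M :: nat where "2 * Q / \<epsilon> < M" using reals_Archimedean2 by blast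
    then have M: "Q / Suc M < \<epsilon> / 2" using \<epsilon> by (simp add: field_simps)
    have "eventually (\<lambda>n. f M n < \<epsilon> / 2) sequentially" using f0[of M] \<epsilon> by (intro order_tendstoD(2)) auto
    moreover have "eventually (\<lambda>n. c \<le> real n) sequentially"
      using filterlim_real_sequentially by (simp add: filterlim_at_top)
    ultimately have "eventually (\<lambda>n. norm (hyp n - 0) < \<epsilon>) sequentially"
    proof eventually_elim
      case (elim n)
      have "0 \<le> hyp n" by (simp add: hyp_def)
      moreover have "hyp n < \<epsilon>" using bound[of n M] elim M by linarith
      ultimately show ?case by simp
    qed
    then show "\<exists>N. \<forall>n\<ge>N. norm (hyp n - 0) < \<epsilon>" by (simp add: eventually_sequentially)
  qed
  then have "(\<lambda>n. 1 - hyp n) \<longlonglongrightarrow> 1 - 0" by (intro tendsto_intros)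
  moreover have "1 - hyp n = measure_pmf.prob (gnp n (c / real n))
      {E. \<not> hyperbolic (H n E) (induced_edges E (H n E)) \<delta>}" for n
    unfolding hyp_def by (subst measure_pmf.prob_compl[symmetric]) (auto simp: Collect_neg_eq Compl_eq_Diff_UNIV)
  ultimately show ?thesis by simp
qed

end
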